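(* Let $\rho$ be a density operator of a two-qubit system with concurrence $C=C(\rho)$. Then $$\mathcal{N}(\rho)\le 2\sqrt{1+C^2},$$ with equality if and only if $\rho\in\mathcal{Q}$, where $$\mathcal{Q}=\{(U_A\otimes U_B)\big(p|\varphi_1\rangle\langle\varphi_1|+(1-p)|\varphi_2\rangle\langle\varphi_2|\big)(U_A\otimes U_B)^\dagger\},$$ with $U_A,U_B$ ranging over unitaries on $\mathbb{C}^2$, $p\in[0,1]$, $|\varphi_1\rangle=\cos\theta|00\rangle+\sin\theta|11\rangle$ and $|\varphi_2\rangle=\sin\theta|00\rangle+\cos\theta|11\rangle$ for some $\theta\in[0,\pi)$.
   Context: $\sigma_1,\sigma_2,\sigma_3$ (also $X,Y,Z$) are the Pauli matrices. A CHSH operator is an operator $S=A\otimes(B+B')+A'\otimes(B-B')$ with $A=\vec a\cdot\vec\sigma$, $A'=\vec a'\cdot\vec\sigma$, $B=\vec b\cdot\vec\sigma$, $B'=\vec b'\cdot\vec\sigma$ for unit vectors $\vec a,\vec a',\vec b,\vec b'\in\mathbb{R}^3$; the nonlocality of a two-qubit state $\rho$ is $\mathcal{N}(\rho)=\max_S\mathrm{tr}(\rho S)$ over all CHSH operators. The concurrence (Wootters) of a two-qubit density operator $\rho$ is $C(\rho)=\max\{0,\lambda_1-\lambda_2-\lambda_3-\lambda_4\}$, where $\lambda_1\ge\lambda_2\ge\lambda_3\ge\lambda_4$ are the eigenvalues of $\sqrt{\sqrt\rho\,\tilde\rho\,\sqrt\rho}$ with $\tilde\rho=(Y\otimes Y)\rho^*(Y\otimes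 Y)$ ($\rho^*$ the complex conjugate in the computational basis); for a pure state $|\psi\rangle$ it equals $|\langle\psi|(Y\otimes Y)|\psi^*\rangle|$. *)

theory Defs
  imports "HOL-Analysis.Analysis"
begin

text \<open>Two-qubit operators are complex matrices indexed by the finite type 2 \<times> 2;
  the index (i,j) corresponds to the computational basis vector |ij>, with
  0, 1 :: 2 the two basis states of a qubit.\<close>

type_synonym qmat = "complex^2^2"
type_synonym qqmat = "complex^(2\<times>2)^(2\<times>2)"
type_synonym qqvec = "complex^(2\<times>2)"

definition adj :: "complex^'n^'n \<Rightarrow> complex^'n^'n" where
  "adj A = (\<chi> i j. cnj (A $ j $ i))"

definition conjm :: "complex^'n^'n \<Rightarrow> complex^'n^'n" where
  "conjm A = (\<chi> i j. cnj (A $ i $ j))"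

definition hermitian :: "complex^'n^'n \<Rightarrow> bool" where
  "hermitian A \<longleftrightarrow> adj A = A"

definition unitary :: "complex^'n^'n \<Rightarrow> bool" where
  "unitary U \<longleftrightarrow> U ** adj U = mat 1 \<and> adj U ** U = mat 1"

definition psd :: "complex^'n^'n \<Rightarrow> bool" where
  "psd A \<longleftrightarrow> hermitian A \<and>
     (\<forall>v::complex^'n. 0 \<le> Re (\<Sum>i\<in>UNIV. cnj (v $ i) * (A *v v) $ i))"

definition density :: "qqmat \<Rightarrow> bool" where
  "density \<rho> \<longleftrightarrow> psd \<rho> \<and> trace \<rho> = 1"

definition msqrt :: "complex^'n^'n \<Rightarrow> complex^'n^'n" where
  "msqrt A = (THE B. psd B \<and> B ** B = A)"

definition eigs_desc :: "qqmat \<Rightarrow> real list" where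
  "eigs_desc R = (THE l. length l = 4 \<and> sorted (rev l) \<and>
      (\<forall>z::complex. det (mat z - R) = (\<Prod>x\<leftarrow>l. z - complex_of_real x)))"

definition kron :: "qmat \<Rightarrow> qmat \<Rightarrow> qqmat" where
  "kron A B = (\<chi> p q. A $ fst p $ fst q * B $ snd p $ snd q)"

definition pauliX :: qmat where
  "pauliX = (\<chi> i j. if i \<noteq> j then 1 else 0)"

definition pauliY :: qmat where
  "pauliY = (\<chi> i j. if i = 0 \<and> j = 1 then - \<i> else if i = 1 \<and> j = 0 then \<i> else 0)"

definition pauliZ :: qmat where
  "pauliZ = (\<chi> i j. if i = j then (if i = 0 then 1 else -1) else 0)"

definition dot_sigma :: "real^3 \<Rightarrow> qmat" where
  "dot_sigma a = (a $ 1) *\<^sub>R pauliX + (a $ 2) *\<^sub>R pauliY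
               + (a $ 3) *\<^sub>R pauliZ"

definition chsh_ops :: "qqmat set" where
  "chsh_ops = {kron (dot_sigma a) (dot_sigma b + dot_sigma b')
               + kron (dot_sigma a') (dot_sigma b - dot_sigma b') |
               a a' b b'. norm a = 1 \<and> norm a' = 1 \<and> norm b = 1 \<and> norm b' = 1}"

text \<open>Nonlocality N(rho) = max over CHSH operators S of tr(rho S) (a real number,
  since rho and S are Hermitian; the maximum exists by compactness).\<close>
definition nonlocality :: "qqmat \<Rightarrow> real" where
  "nonlocality \<rho> = (SUP S\<in>chsh_ops. Re (trace (\<rho> ** S)))"

definition concurrence :: "qqmat \<Rightarrow> real" where
  "concurrence \<rho> =
    (let Yt = kron pauliY pauliY;
         \<rho>t = Yt ** conjm \<rho> ** Yt;
         R = msqrt (msqrt \<rho> ** \<rho>t ** msqrt \<rho>);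
         l = eigs_desc R
     in max 0 (l ! 0 - l ! 1 - l ! 2 - l ! 3))"

definition proj :: "qqvec \<Rightarrow> qqmat" where
  "proj v = (\<chi> i j. v $ i * cnj (v $ j))"

definition phi1 :: "real \<Rightarrow> qqvec" where
  "phi1 \<theta> = (\<chi> p. if p = (0,0) then complex_of_real (cos \<theta>)
                  else if p = (1,1) then complex_of_real (sin \<theta>) else 0)"

definition phi2 :: "real \<Rightarrow> qqvec" where
  "phi2 \<theta> = (\<chi> p. if p = (0,0) then complex_of_real (sin \<theta>)
                  else if p = (1,1) then complex_of_real (cos \<theta>) else 0)"

definition Qset :: "qqmat set" where
  "Qset = {kron UA UB ** (p *\<^sub>R proj (phi1 \<theta>)
                          + (1 - p) *\<^sub>R proj (phi2 \<theta>)) ** adj (kron UA UB) |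
           UA UB p \<theta>. unitary UA \<and> unitary UB \<and> 0 \<le> p \<and> p \<le> 1 \<and> 0 \<le> \<theta> \<and> \<theta> < pi}"

end

theory Submission
  imports Defs "HOL-Computational_Algebra.Polynomial"
begin

text \<open>Writing \<open>\<rho> = W W\<^sup>\<dagger>\<close> with \<open>W\<^sup>t (Y \<otimes> Y) W\<close> diagonal (Autonne--Takagi), the moduli of the diagonal
  entries are the numbers \<open>\<lambda>\<^sub>i\<close> in the definition of the concurrence \<open>C\<close>. Wootters' construction turns
  \<open>W\<close> into a decomposition \<open>\<rho> = \<Sum> |z\<^sub>i><z\<^sub>i|\<close> in which every \<open>z\<^sub>i\<close> has concurrence \<open>C\<close> relative to its weight
  \<open>n\<^sub>i\<close>. For one such vector with correlation matrix \<open>T\<close> and Bloch vector \<open>\<beta>\<close> one has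
  \<open>T\<^sup>t T = c\<^sup>2 + \<beta> \<beta>\<^sup>t\<close> with \<open>c = C n\<^sub>i\<close>, so the CHSH value is at most \<open>2 n\<^sub>i sqrt (1 + C\<^sup>2)\<close>, and summing gives the bound.
  In the case of equality the same CHSH operator is optimal for every \<open>z\<^sub>i\<close>, which fixes \<open>T\<close> up to the factor \<open>n\<^sub>i\<close>
  on a plane containing \<open>\<beta>\<close>; hence \<open>\<rho>\<close> is perfectly correlated for some pair of local spin measurements,
  and after a local rotation it is supported on the span of \<open>|00>\<close> and \<open>|11>\<close>.\<close>

text \<open>The pieces need equal relative concurrence, not just the average \<open>C\<close>: the
  pure-state bound is convex in the relative concurrence, so averaging it over an arbitrary
  decomposition can only overshoot. The bound for one piece rests on an identity, not an estimate:
  for orthonormal \<open>e\<close>, \<open>e'\<close> along \<open>b + b'\<close> and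
  \<open>b - b'\<close>, the squared lengths of \<open>T e\<close> and \<open>T e'\<close> add up to
  \<open>n\<^sup>2 * (1 + C\<^sup>2)\<close> minus the squared length of the part of \<beta> outside
  their plane. Completing squares then displays every defect at once, so the equality case is read
  off the same formula. A unit vector of the plane along \<beta> is sent by \<open>T\<close> to a
  vector of squared length \<open>c\<^sup>2 + \<beta> \<bullet> \<beta> = n\<^sup>2\<close>, which
  is why the correlation is perfect; if \<beta> vanishes, then \<open>c = n\<close> and any
  direction of the plane serves. As \<open>concurrence\<close> passes through two definite
  descriptions, uniqueness of square roots and of spectra comes first; equality of the spectra of
  \<open>A ** B\<close> and \<open>B ** A\<close> then lets any factor \<open>W\<close> stand in for
  the square root of \<rho>.\<close>

section \<open>Eigenbases of self-adjoint and conjugate-linear maps\<close>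

text \<open>One induction serves complex-linear maps (\<open>J\<close> is multiplication by
  \<open>\<i>\<close>, \<open>c = 1\<close>), conjugate-linear ones (\<open>c = -1\<close>) and real
  ones (\<open>J = id\<close>, \<open>m = 1\<close>). Orthogonality to \<open>J (v j)\<close> as
  well upgrades real orthogonality to complex orthogonality. The next eigenvector maximises the
  Rayleigh quotient on the complement of all \<open>v j\<close> and \<open>J (v j)\<close>, which
  \<open>T\<close> preserves; \<open>m * CARD('n) \<le> DIM('a)\<close> keeps that complement
  nonzero.\<close>

lemma self_adjoint_orthonormal_eigenvectors:
  fixes T J :: "'a::euclidean_space \<Rightarrow> 'a" and F :: "'n::finite set"
  assumes "linear T" "linear J"
    and sa: "\<And>v w. T v \<bullet> w = v \<bullet> T w"
    and TJ: "\<And>v. T (J v) = c *\<^sub>R J (T v)"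
    and adjJ: "\<And>v w. J v \<bullet> w = d * (v \<bullet> J w)"
    and m: "\<And>v. card {v, J v} \<le> m" "m * CARD('n) \<le> DIM('a)" "0 < m"
  shows "\<exists>v \<mu>. (\<forall>j\<in>F. T (v j) = \<mu> j *\<^sub>R v j \<and> norm (v j) = 1) \<and>
           (\<forall>j\<in>F. \<forall>k\<in>F. j \<noteq> k \<longrightarrow> v j \<bullet> v k = 0 \<and> J (v j) \<bullet> v k = 0)"
proof (induction F rule: finite_induct[OF finite])
  case 1
  then show ?case by simp
next
  case (2 x F)
  interpret T: linear T by fact
  interpret J: linear J by fact
  from 2(3) obtain v \<mu> where
      "\<forall>j\<in>F. T (v j) = \<mu> j *\<^sub>R v j \<and> norm (v j) = 1"
      "\<forall>j\<in>F. \<forall>k\<in>F. j \<noteq> k \<longrightarrow> v j \<bullet> v k = 0 \<and> J (v j) \<bullet> v k = 0"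
    by (elim exE conjE)
  then have ev: "\<And>j. j \<in> F \<Longrightarrow> T (v j) = \<mu> j *\<^sub>R v j \<and> norm (v j) = 1"
    and orth: "\<And>j k. j \<in> F \<Longrightarrow> k \<in> F \<Longrightarrow> j \<noteq> k \<Longrightarrow> v j \<bullet> v k = 0 \<and> J (v j) \<bullet> v k = 0"
    by auto
  define B where "B = (\<Union>j\<in>F. {v j, J (v j)})"
  define S where "S = {w. \<forall>b\<in>B. b \<bullet> w = 0}"
  have "card B \<le> (\<Sum>j\<in>F. card {v j, J (v j)})"
    unfolding B_def by (rule card_UN_le) simp
  also have "\<dots> \<le> (\<Sum>j\<in>F. m)" by (rule sum_mono) (rule m)
  also have "\<dots> = m * card F" by simp
  also have "\<dots> < m * CARD('n)"
  proof -
    have "F \<subset> UNIV" using 2(2) by blast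
    then have "card F < CARD('n)" by (simp add: psubset_card_mono)
    then show ?thesis using m by simp
  qed
  finally have "card B < DIM('a)" using m by simp
  moreover have "dim B \<le> card B" by (rule dim_le_card') (simp add: B_def)
  ultimately have "dim B < DIM('a)" by simp
  then obtain y where y: "y \<noteq> 0" "\<And>b. b \<in> span B \<Longrightarrow> orthogonal y b"
    using orthogonal_to_subspace_exists by blast
  have yS: "y \<in> S"
    unfolding S_def using y(2) by (auto simp: orthogonal_def inner_commute intro: span_base)
  have subS: "subspace S"
    unfolding S_def subspace_def by (auto simp: inner_add_right)
  have closedS: "closed S"
    using subS by (rule closed_subspace)
  have TS: "T w \<in> S" if "w \<in> S" for w
  proof -
    have "v j \<bullet> T w = 0 \<and> J (v j) \<bullet> T w = 0" if j: "j \<in> F" for j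
    proof -
      have 1: "v j \<bullet> w = 0" "J (v j) \<bullet> w = 0"
        using \<open>w \<in> S\<close> j unfolding S_def B_def by auto
      have "v j \<bullet> T w = T (v j) \<bullet> w" by (simp add: sa)
      moreover have "J (v j) \<bullet> T w = T (J (v j)) \<bullet> w" by (simp add: sa)
      ultimately show ?thesis using 1 ev[OF j] by (simp add: TJ J.scale)
    qed
    then show ?thesis unfolding S_def B_def by auto
  qed
  have comp: "compact (S \<inter> sphere 0 1)" using closedS by (simp add: closed_Int_compact)
  have "(1 / norm y) *\<^sub>R y \<in> S \<inter> sphere 0 1"
    using y yS subS by (simp add: subspace_scale)
  then have ne: "S \<inter> sphere 0 1 \<noteq> {}" by blast
  have contT: "continuous_on A T" for A
    by (rule linear_continuous_on) (simp add: linear_linear assms)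
  have "continuous_on (S \<inter> sphere 0 1) (\<lambda>w. w \<bullet> T w)"
    by (intro continuous_intros contT)
  from continuous_attains_sup[OF comp ne this]
  obtain u where u0: "u \<in> S \<inter> sphere 0 1"
    and u1: "\<forall>w\<in>S \<inter> sphere 0 1. w \<bullet> T w \<le> u \<bullet> T u" ..
  have u: "u \<in> S" "norm u = 1" using u0 by auto
  have umax: "w \<bullet> T w \<le> u \<bullet> T u" if "w \<in> S" "norm w = 1" for w
    using u1 that by auto
  define \<nu> where "\<nu> = u \<bullet> T u"
  have bound: "w \<bullet> T w \<le> \<nu> * (w \<bullet> w)" if "w \<in> S" for w
  proof (cases "w = 0")
    case False
    have "((1 / norm w) *\<^sub>R w) \<bullet> T ((1 / norm w) *\<^sub>R w) \<le> \<nu>"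
      unfolding \<nu>_def using False that subS by (intro umax) (auto simp: subspace_scale)
    then show ?thesis using False
      by (simp add: T.scale field_simps power2_norm_eq_inner[symmetric] power2_eq_square)
  qed (simp add: T.zero)
  \<comment> \<open>First variation: along \<open>u + t *\<^sub>R w\<close> the slack in
    \<open>bound\<close> is \<open>p * t + q * t\<^sup>2\<close>, which is nonnegative and vanishes
    at \<open>t = 0\<close>, so its linear coefficient is zero.\<close>
  have crit: "(\<nu> *\<^sub>R u - T u) \<bullet> w = 0" if w: "w \<in> S" for w
  proof -
    define p where "p = 2 * ((\<nu> *\<^sub>R u - T u) \<bullet> w)"
    define q where "q = \<nu> * (w \<bullet> w) - w \<bullet> T w"
    have uu: "u \<bullet> u = 1" using u by (simp add: norm_eq_1)
    have "0 \<le> p * t + q * t\<^sup>2" for t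
    proof -
      have "u + t *\<^sub>R w \<in> S" using u w subS by (simp add: subspace_add subspace_scale)
      from bound[OF this] have "u \<bullet> T u + t * (u \<bullet> T w) + t * (w \<bullet> T u) + t\<^sup>2 * (w \<bullet> T w)
           \<le> \<nu> * (1 + 2 * t * (u \<bullet> w) + t\<^sup>2 * (w \<bullet> w))"
        by (simp add: T.add T.scale inner_simps uu inner_commute algebra_simps power2_eq_square)
      moreover have "u \<bullet> T w = T u \<bullet> w" "w \<bullet> T u = T u \<bullet> w"
        using sa by (auto simp: inner_commute)
      ultimately show ?thesis
        unfolding p_def q_def by (simp add: \<nu>_def[symmetric] inner_simps algebra_simps)
    qed
    note ge = this
    have "p = 0"
    proof (rule ccontr)
      assume p: "p \<noteq> 0"
      \<comment> \<open>Small enough that the linear term dominates at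
        \<open>t = - p * e\<close>.\<close>
      define e where "e = 1 / (1 + \<bar>q\<bar>)"
      have e: "0 < e" "q * e < 1"
        unfolding e_def by (auto simp: field_simps abs_if)
      have "p * (- p * e) + q * (- p * e)\<^sup>2 = p\<^sup>2 * e * (q * e - 1)"
        by (simp add: power2_eq_square algebra_simps)
      also have "\<dots> < 0"
        using p e by (intro mult_pos_neg) auto
      finally show False using ge[of "- p * e"] by simp
    qed
    then show ?thesis by (simp add: p_def)
  qed
  have "\<nu> *\<^sub>R u - T u \<in> S" using u subS TS by (simp add: subspace_diff subspace_scale)
  \<comment> \<open>The residual lies in \<open>S\<close>, hence is orthogonal to itself.\<close>
  from crit[OF this] have Tu: "T u = \<nu> *\<^sub>R u" by simp
  have new: "v j \<bullet> u = 0 \<and> J (v j) \<bullet> u = 0 \<and> u \<bullet> v j = 0 \<and> J u \<bullet> v j = 0" if "j \<in> F" for j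
  proof -
    have "v j \<bullet> u = 0" "J (v j) \<bullet> u = 0" using u that unfolding S_def B_def by auto
    then show ?thesis by (simp add: adjJ[of u] inner_commute)
  qed
  have "x \<notin> F" by fact
  then show ?case
    using ev orth new Tu u(2)
    by (intro exI[of _ "v(x := u)"] exI[of _ "\<mu>(x := \<nu>)"]) auto
qed

section \<open>Entrywise calculus of diagonal, adjoint, conjugate and unitary matrices\<close>

definition diagm :: "('n \<Rightarrow> 'a::zero) \<Rightarrow> 'a^'n^'n" where
  "diagm d = (\<chi> i j. if i = j then d i else 0)"

definition cscale :: "complex \<Rightarrow> complex^'n \<Rightarrow> complex^'n" where
  "cscale c v = (\<chi> i. c * v $ i)"

lemma diagm_nth [simp]: "diagm d $ i $ j = (if i = j then d i else 0)"
  by (simp add: diagm_def)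

lemma adj_nth [simp]: "adj A $ i $ j = cnj (A $ j $ i)"
  by (simp add: adj_def)

lemma conjm_nth [simp]: "conjm A $ i $ j = cnj (A $ i $ j)"
  by (simp add: conjm_def)

lemma matrix_mult_nth: "(A ** B) $ i $ j = (\<Sum>k\<in>UNIV. A $ i $ k * B $ k $ j)"
  by (simp add: matrix_matrix_mult_def)

lemma matrix_add_rdistrib: "(A + B) ** C = A ** C + B ** C"
  by (simp add: vec_eq_iff matrix_mult_nth algebra_simps sum.distrib)

lemma matrix_sub_rdistrib: "(A - B) ** C = A ** C - B ** C"
  for A B :: "'a::ring_1^'n^'m"
  by (simp add: vec_eq_iff matrix_mult_nth algebra_simps sum_subtractf)

lemma matrix_sub_ldistrib: "A ** (B - C) = A ** B - A ** C"
  for A :: "'a::ring_1^'n^'m"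
  by (simp add: vec_eq_iff matrix_mult_nth algebra_simps sum_subtractf)

lemma mult_diagm_nth [simp]:
  fixes A :: "'a::semiring_1^'n^'m"
  shows "(A ** diagm d) $ i $ j = A $ i $ j * d j"
  by (simp add: matrix_mult_nth if_distrib cong: if_cong)

lemma diagm_mult_nth [simp]:
  fixes A :: "'a::semiring_1^'m^'n"
  shows "(diagm d ** A) $ i $ j = d i * A $ i $ j"
  by (simp add: matrix_mult_nth if_distrib[where f="\<lambda>x. x * _"] cong: if_cong)

lemma mat_eq_diagm: "mat z = diagm (\<lambda>_. z)"
  by (simp add: mat_def diagm_def)

lemma adj_adj [simp]: "adj (adj A) = A"
  by (simp add: vec_eq_iff)

lemma adj_mult: "adj (A ** B) = adj B ** adj A"
  by (simp add: vec_eq_iff matrix_mult_nth mult.commute)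

lemma adj_mat [simp]: "adj (mat 1) = mat 1"
  by (simp add: vec_eq_iff mat_def)

lemma conjm_mult: "conjm (A ** B) = conjm A ** conjm B"
  by (simp add: vec_eq_iff matrix_mult_nth)

lemma conjm_mat [simp]: "conjm (mat 1) = mat 1"
  by (simp add: vec_eq_iff mat_def)

lemma conjm_conjm [simp]: "conjm (conjm A) = A"
  by (simp add: vec_eq_iff)

lemma transpose_eq_conjm_adj: "transpose A = conjm (adj A)"
  by (simp add: vec_eq_iff transpose_def)

lemma adj_conjm: "adj (conjm A) = conjm (adj A)"
  by (simp add: vec_eq_iff)

lemma unitary_iff: "unitary U \<longleftrightarrow> adj U ** U = mat 1"
  unfolding unitary_def using matrix_left_right_inverse by blast

lemma unitaryD: "unitary U \<Longrightarrow> adj U ** U = mat 1" "unitary U \<Longrightarrow> U ** adj U = mat 1"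
  by (auto simp: unitary_def)

lemma unitary_mult: "unitary U \<Longrightarrow> unitary V \<Longrightarrow> unitary (U ** V)"
  unfolding unitary_iff
  by (metis adj_mult matrix_mul_assoc matrix_mul_lid)

lemma unitary_mat [simp]: "unitary (mat 1)"
  by (simp add: unitary_def)

lemma diagm_mult_diagm: "diagm d ** diagm e = diagm (\<lambda>i. d i * e i :: 'a::semiring_1)"
  by (simp add: vec_eq_iff)

lemma adj_diagm: "adj (diagm d) = diagm (\<lambda>i. cnj (d i))"
  by (auto simp: vec_eq_iff)

lemma unitary_diagm: "(\<And>i. cmod (d i) = 1) \<Longrightarrow> unitary (diagm d)"
  by (auto simp: unitary_iff vec_eq_iff mat_def complex_norm_square[symmetric] mult.commute)

lemma inner_complex_vec: "v \<bullet> w = Re (\<Sum>i\<in>UNIV. cnj (v $ i) * w $ i)" for v w :: "complex^'n"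
  by (simp add: inner_vec_def inner_complex_def)

lemma inner_cscale_ii:
  "cscale \<i> v \<bullet> w = Im (\<Sum>i\<in>UNIV. cnj (v $ i) * w $ i)" for v w :: "complex^'n"
  by (simp add: inner_vec_def inner_complex_def cscale_def)

lemma scaleR_vec_nth_complex: "(r *\<^sub>R v) $ i = complex_of_real r * v $ i" for v :: "complex^'n"
  by (simp add: complex_eq_iff)

text \<open>The real inner products of \<open>v\<close> and \<open>cscale \<i> v\<close> with
  \<open>w\<close> are the real and imaginary parts of the Hermitian product, so the real
  orthonormal family is the set of columns of a unitary matrix. Both signs of \<open>c\<close> give
  real eigenvalues, which makes the spectral theorem and the Takagi factorisation two instances of
  one statement.\<close>

lemma semilinear_eigenbasis:
  fixes T :: "complex^'n \<Rightarrow> complex^'n"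
  assumes "linear T" "\<And>v w. T v \<bullet> w = v \<bullet> T w"
    and "\<And>v. T (cscale \<i> v) = c *\<^sub>R cscale \<i> (T v)"
  obtains U \<mu> where "unitary U" "\<And>j. T (column j U) = \<mu> j *\<^sub>R column j U"
proof -
  have J: "linear (cscale \<i> :: complex^'n \<Rightarrow> _)"
    by (rule linearI) (auto simp: cscale_def vec_eq_iff algebra_simps)
  have adjJ: "cscale \<i> v \<bullet> w = - 1 * (v \<bullet> cscale \<i> w)" for v w :: "complex^'n"
    by (simp add: inner_vec_def inner_complex_def cscale_def sum_negf[symmetric] algebra_simps)
  have "card {v, cscale \<i> v} \<le> 2" for v :: "complex^'n"
    by (simp add: card_insert_if)
  from self_adjoint_orthonormal_eigenvectors[OF assms(1) J assms(2,3) adjJ this, where F="UNIV :: 'n set"]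
  obtain v \<mu> where ev: "\<And>j::'n. T (v j) = \<mu> j *\<^sub>R v j \<and> norm (v j) = 1"
    and orth: "\<And>j k. j \<noteq> k \<Longrightarrow> v j \<bullet> v k = 0 \<and> cscale \<i> (v j) \<bullet> v k = 0"
    by auto
  define U where "U = (\<chi> i j. v j $ i)"
  have col: "column j U = v j" for j
    by (simp add: column_def U_def vec_eq_iff)
  have "(\<Sum>i\<in>UNIV. cnj (v j $ i) * v k $ i) = (if j = k then 1 else 0)" for j k
  proof (cases "j = k")
    case True
    have "v j \<bullet> v j = 1" using ev[of j] by (simp add: norm_eq_1)
    moreover have "Im (\<Sum>i\<in>UNIV. cnj (v j $ i) * v j $ i) = 0"
      by (simp add: mult.commute)
    ultimately show ?thesis using True by (simp add: complex_eq_iff inner_complex_vec)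
  next
    case False
    then show ?thesis using orth[OF False]
      by (simp only: inner_cscale_ii, simp only: inner_complex_vec complex_eq_iff) simp
  qed
  then have "unitary U"
    by (simp add: unitary_iff vec_eq_iff matrix_mult_nth mat_def U_def)
  then show ?thesis using ev col by (intro that[of U \<mu>]) auto
qed

lemma hermitian_inner:
  assumes "hermitian A"
  shows "(A *v v) \<bullet> w = v \<bullet> (A *v w)"
proof -
  have A: "cnj (A $ i $ j) = A $ j $ i" for i j
    using assms by (metis hermitian_def adj_nth)
  have "(\<Sum>i\<in>UNIV. cnj ((A *v v) $ i) * w $ i) = (\<Sum>i\<in>UNIV. \<Sum>j\<in>UNIV. A $ j $ i * cnj (v $ j) * w $ i)"
    by (simp add: matrix_vector_mult_def sum_distrib_right A)
  also have "\<dots> = (\<Sum>j\<in>UNIV. \<Sum>i\<in>UNIV. A $ j $ i * cnj (v $ j) * w $ i)"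
    by (rule sum.swap)
  also have "\<dots> = (\<Sum>j\<in>UNIV. cnj (v $ j) * (A *v w) $ j)"
    by (simp add: matrix_vector_mult_def sum_distrib_left mult_ac)
  finally show ?thesis by (simp only: inner_complex_vec)
qed

lemma hermitian_diagonalisation:
  fixes A :: "complex^'n^'n"
  assumes "hermitian A"
  obtains U and \<mu> :: "'n \<Rightarrow> real"
  where "unitary U" "A = U ** diagm (\<lambda>i. complex_of_real (\<mu> i)) ** adj U"
proof -
  have "linear ((*v) A)"
    by (rule linearI) (auto simp: matrix_vector_mult_def vec_eq_iff algebra_simps sum.distrib scaleR_sum_right)
  moreover have "A *v cscale \<i> v = 1 *\<^sub>R cscale \<i> (A *v v)" for v
    by (simp add: matrix_vector_mult_def cscale_def vec_eq_iff sum_distrib_left mult_ac)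
  ultimately obtain U \<mu> where U: "unitary U" and ev: "\<And>j. A *v column j U = \<mu> j *\<^sub>R column j U"
    using semilinear_eigenbasis[OF _ hermitian_inner[OF assms]] by metis
  have "(A ** U) $ i $ j = (U ** diagm (\<lambda>i. complex_of_real (\<mu> i))) $ i $ j" for i j
  proof -
    have "(A ** U) $ i $ j = (A *v column j U) $ i"
      by (simp add: matrix_mult_nth matrix_vector_mult_def column_def)
    then show ?thesis unfolding ev scaleR_vec_nth_complex by (simp add: column_def mult.commute)
  qed
  then have "A ** U = U ** diagm (\<lambda>i. complex_of_real (\<mu> i))"
    by (simp add: vec_eq_iff)
  then have "A = U ** diagm (\<lambda>i. complex_of_real (\<mu> i)) ** adj U"
    by (metis U unitaryD(2) matrix_mul_assoc matrix_mul_rid)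
  then show ?thesis using U that by blast
qed

text \<open>The map \<open>v \<mapsto> conjugate (A v)\<close> is conjugate-linear and, because
  \<open>A\<close> is symmetric, self-adjoint for the real inner product.\<close>

lemma takagi_factorisation:
  fixes A :: "complex^'n^'n"
  assumes "transpose A = A"
  obtains U and \<mu> :: "'n \<Rightarrow> real"
  where "unitary U" "transpose U ** A ** U = diagm (\<lambda>i. complex_of_real (\<mu> i))"
proof -
  define T where "T = (\<lambda>v. \<chi> i. cnj ((A *v v) $ i))"
  have sym: "A $ i $ j = A $ j $ i" for i j
    using assms by (metis transpose_def vec_lambda_beta)
  have "linear T"
    by (rule linearI) (auto simp: T_def matrix_vector_mult_def vec_eq_iff algebra_simps sum.distrib scaleR_sum_right)
  moreover have "T v \<bullet> w = v \<bullet> T w" for v w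
  proof -
    have "(\<Sum>i\<in>UNIV. cnj (T v $ i) * w $ i) = (\<Sum>i\<in>UNIV. \<Sum>j\<in>UNIV. A $ i $ j * v $ j * w $ i)"
      by (simp add: T_def matrix_vector_mult_def sum_distrib_right)
    also have "\<dots> = (\<Sum>j\<in>UNIV. \<Sum>i\<in>UNIV. A $ i $ j * v $ j * w $ i)"
      by (rule sum.swap)
    also have "\<dots> = (\<Sum>j\<in>UNIV. \<Sum>i\<in>UNIV. A $ j $ i * v $ j * w $ i)"
      by (simp only: sym)
    also have "\<dots> = cnj (\<Sum>j\<in>UNIV. cnj (v $ j) * T w $ j)"
      by (simp add: T_def matrix_vector_mult_def sum_distrib_left mult_ac)
    finally show ?thesis by (simp only: inner_complex_vec cnj.simps)
  qed
  moreover have "T (cscale \<i> v) = (-1) *\<^sub>R cscale \<i> (T v)" for v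
    by (simp add: T_def matrix_vector_mult_def cscale_def vec_eq_iff sum_distrib_left mult_ac sum_negf)
  ultimately obtain U \<mu> where U: "unitary U" and ev: "\<And>j. T (column j U) = \<mu> j *\<^sub>R column j U"
    using semilinear_eigenbasis by metis
  have "(A ** U) $ i $ j = (conjm U ** diagm (\<lambda>i. complex_of_real (\<mu> i))) $ i $ j" for i j
  proof -
    have "(A ** U) $ i $ j = cnj (T (column j U) $ i)"
      by (simp add: T_def matrix_mult_nth matrix_vector_mult_def column_def)
    then show ?thesis unfolding ev scaleR_vec_nth_complex by (simp add: column_def mult.commute)
  qed
  then have "A ** U = conjm U ** diagm (\<lambda>i. complex_of_real (\<mu> i))"
    by (simp add: vec_eq_iff)
  moreover have "transpose U ** conjm U = mat 1"
    using unitaryD(1)[OF U] by (metis transpose_eq_conjm_adj conjm_mult conjm_mat)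
  ultimately have "transpose U ** A ** U = diagm (\<lambda>i. complex_of_real (\<mu> i))"
    by (metis matrix_mul_assoc matrix_mul_lid)
  then show ?thesis using U that by blast
qed

lemma real_symmetric_diagonalisation:
  fixes A :: "real^'n^'n"
  assumes "transpose A = A"
  obtains U :: "real^'n^'n" and \<mu> where "transpose U ** U = mat 1" "transpose U ** A ** U = diagm \<mu>"
proof -
  have "linear ((*v) A)" by simp
  moreover have sa: "(A *v v) \<bullet> w = v \<bullet> (A *v w)" for v w
    using assms by (metis dot_lmul_matrix vector_transpose_matrix)
  moreover have "linear (id :: real^'n \<Rightarrow> _)" by (rule linear_id)
  ultimately obtain v \<mu> where ev: "\<And>j::'n. A *v v j = \<mu> j *\<^sub>R v j \<and> norm (v j) = 1"
    and orth: "\<And>j k. j \<noteq> k \<Longrightarrow> v j \<bullet> v k = 0"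
    using self_adjoint_orthonormal_eigenvectors[where T="(*v) A" and J=id and c=1 and d=1 and m=1
        and F="UNIV :: 'n set"] by auto
  define U where "U = (\<chi> i j. v j $ i)"
  have vv: "v j \<bullet> v k = (if j = k then 1 else 0)" for j k
    using orth[of j k] ev[of j] by (auto simp: norm_eq_1)
  have "transpose U ** U = mat 1"
    using vv by (simp add: vec_eq_iff matrix_mult_nth mat_def U_def transpose_def inner_vec_def)
  moreover have "(transpose U ** A ** U) $ j $ k = diagm \<mu> $ j $ k" for j k
  proof -
    have "(transpose U ** A ** U) $ j $ k = v j \<bullet> (A *v v k)"
      by (simp add: matrix_mul_assoc[symmetric] matrix_mult_nth U_def transpose_def
          inner_vec_def matrix_vector_mult_def)
    then show ?thesis using ev[of k] vv[of j k] by simp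
  qed
  ultimately show ?thesis by (intro that[of U \<mu>]) (auto simp: vec_eq_iff)
qed

section \<open>Positive semidefinite matrices and their spectra\<close>

lemma quadratic_form_mult_adj:
  fixes A :: "complex^'n^'n"
  shows "(\<Sum>i\<in>UNIV. cnj (v $ i) * ((A ** adj A) *v v) $ i) =
    complex_of_real (\<Sum>k\<in>UNIV. (cmod ((adj A *v v) $ k))\<^sup>2)"
proof -
  have "(\<Sum>i\<in>UNIV. cnj (v $ i) * ((A ** adj A) *v v) $ i)
      = (\<Sum>i\<in>UNIV. \<Sum>k\<in>UNIV. cnj (v $ i) * (A $ i $ k * (adj A *v v) $ k))"
    by (simp add: matrix_vector_mul_assoc[symmetric] matrix_vector_mult_def[of A] sum_distrib_left)
  also have "\<dots> = (\<Sum>k\<in>UNIV. \<Sum>i\<in>UNIV. cnj (v $ i) * (A $ i $ k * (adj A *v v) $ k))"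
    by (rule sum.swap)
  also have "\<dots> = (\<Sum>k\<in>UNIV. cnj ((adj A *v v) $ k) * (adj A *v v) $ k)"
  proof (rule sum.cong[OF refl])
    fix k
    have "cnj ((adj A *v v) $ k) = (\<Sum>i\<in>UNIV. cnj (v $ i) * A $ i $ k)"
      by (simp add: matrix_vector_mult_def mult.commute)
    then show "(\<Sum>i\<in>UNIV. cnj (v $ i) * (A $ i $ k * (adj A *v v) $ k)) = cnj ((adj A *v v) $ k) * (adj A *v v) $ k"
      by (simp only: sum_distrib_right mult.assoc)
  qed
  also have "\<dots> = (\<Sum>k\<in>UNIV. complex_of_real ((cmod ((adj A *v v) $ k))\<^sup>2))"
    by (simp only: complex_norm_square mult.commute)
  finally show ?thesis by simp
qed

lemma psd_mult_adj: "psd (A ** adj A)"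
  unfolding psd_def
  by (simp only: quadratic_form_mult_adj hermitian_def adj_mult adj_adj) (simp add: sum_nonneg)

lemma psd_conj_diagm:
  assumes "\<And>i. 0 \<le> \<mu> i"
  shows "psd (U ** diagm (\<lambda>i. complex_of_real (\<mu> i)) ** adj U)"
proof -
  define S where "S = diagm (\<lambda>i. complex_of_real (sqrt (\<mu> i)))"
  have "S ** adj S = diagm (\<lambda>i. complex_of_real (\<mu> i))"
    unfolding S_def adj_diagm diagm_mult_diagm using assms
    by (auto simp: vec_eq_iff of_real_mult[symmetric] simp del: of_real_mult)
  then have "U ** diagm (\<lambda>i. complex_of_real (\<mu> i)) ** adj U = (U ** S) ** adj (U ** S)"
    by (simp add: adj_mult matrix_mul_assoc[symmetric]) (simp add: matrix_mul_assoc)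
  then show ?thesis by (simp add: psd_mult_adj)
qed

lemma psd_diagonalisation:
  fixes A :: "complex^'n^'n"
  assumes "psd A"
  obtains U and \<mu> :: "'n \<Rightarrow> real" where "unitary U" "\<And>i. 0 \<le> \<mu> i"
    "A = U ** diagm (\<lambda>i. complex_of_real (\<mu> i)) ** adj U"
proof -
  obtain U \<mu> where U: "unitary U" and A: "A = U ** diagm (\<lambda>i. complex_of_real (\<mu> i)) ** adj U"
    using assms hermitian_diagonalisation unfolding psd_def by blast
  have "adj U ** A ** U = diagm (\<lambda>i. complex_of_real (\<mu> i))"
    unfolding A using unitaryD(1)[OF U]
    by (metis matrix_mul_assoc matrix_mul_lid matrix_mul_rid)
  then have "complex_of_real (\<mu> j) = (adj U ** (A ** U)) $ j $ j" for j
    by (simp add: matrix_mul_assoc)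
  also have "(adj U ** (A ** U)) $ j $ j = (\<Sum>i\<in>UNIV. cnj (column j U $ i) * (A *v column j U) $ i)" for j
    by (simp add: matrix_mult_nth matrix_vector_mult_def column_def)
  finally have "\<mu> j = Re (\<Sum>i\<in>UNIV. cnj (column j U $ i) * (A *v column j U) $ i)" for j
    by (metis Re_complex_of_real)
  then have "0 \<le> \<mu> j" for j
    using assms unfolding psd_def by metis
  then show ?thesis using U A that by blast
qed

text \<open>The matrix \<open>Q = adj U ** V\<close> intertwines the two squared spectra: wherever
  an entry of \<open>Q\<close> is nonzero the squared eigenvalues agree, hence by nonnegativity the
  eigenvalues themselves, so \<open>Q\<close> already intertwines the roots. This gives the
  description in \<open>msqrt\<close> its uniqueness.\<close>

lemma psd_square_unique:
  assumes "psd B" "psd C" "B ** B = C ** C"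
  shows "B = C"
proof -
  obtain U \<mu> where U: "unitary U" "\<And>i. 0 \<le> \<mu> i" and B: "B = U ** diagm (\<lambda>i. complex_of_real (\<mu> i)) ** adj U"
    using psd_diagonalisation assms by blast
  obtain V \<nu> where V: "unitary V" "\<And>i. 0 \<le> \<nu> i" and C: "C = V ** diagm (\<lambda>i. complex_of_real (\<nu> i)) ** adj V"
    using psd_diagonalisation assms by blast
  define D where "D = diagm (\<lambda>i. complex_of_real (\<mu> i))"
  define E where "E = diagm (\<lambda>i. complex_of_real (\<nu> i))"
  define Q where "Q = adj U ** V"
  have UU: "adj U ** U = mat 1" "U ** adj U = mat 1" and VV: "adj V ** V = mat 1" "V ** adj V = mat 1"
    using U V unitaryD by auto
  have "adj U ** (B ** B) ** V = (adj U ** U) ** D ** (adj U ** U) ** D ** (adj U ** V)"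
    unfolding B D_def by (simp only: matrix_mul_assoc)
  then have 1: "adj U ** (B ** B) ** V = D ** D ** Q" by (simp add: UU Q_def)
  have "adj U ** (C ** C) ** V = (adj U ** V) ** E ** (adj V ** V) ** E ** (adj V ** V)"
    unfolding C E_def by (simp only: matrix_mul_assoc)
  then have 2: "adj U ** (C ** C) ** V = Q ** (E ** E)" by (simp add: VV Q_def matrix_mul_assoc)
  have "D ** D ** Q = Q ** (E ** E)" using 1 2 assms by simp
  then have eq: "complex_of_real (\<mu> i * \<mu> i) * Q $ i $ j = Q $ i $ j * complex_of_real (\<nu> j * \<nu> j)" for i j
    unfolding D_def E_def diagm_mult_diagm vec_eq_iff by simp
  have "complex_of_real (\<mu> i) * Q $ i $ j = Q $ i $ j * complex_of_real (\<nu> j)" for i j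
  proof (cases "Q $ i $ j = 0")
    case False
    then have "complex_of_real (\<mu> i * \<mu> i) = complex_of_real (\<nu> j * \<nu> j)"
      using eq[of i j] by simp
    then have "\<mu> i * \<mu> i = \<nu> j * \<nu> j" using of_real_eq_iff by blast
    then have "\<mu> i = \<nu> j" using U(2)[of i] V(2)[of j]
      by (metis abs_mult_self_eq abs_of_nonneg real_sqrt_abs2)
    then show ?thesis by simp
  qed simp
  then have "D ** Q = Q ** E" by (simp add: vec_eq_iff D_def E_def)
  then have "U ** (D ** Q) ** adj V = U ** (Q ** E) ** adj V" by simp
  moreover have "U ** (D ** Q) ** adj V = U ** D ** adj U ** (V ** adj V)"
    unfolding Q_def by (simp only: matrix_mul_assoc)
  moreover have "U ** (Q ** E) ** adj V = (U ** adj U) ** (V ** E ** adj V)"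
    unfolding Q_def by (simp only: matrix_mul_assoc)
  ultimately show ?thesis unfolding UU VV B C D_def E_def by simp
qed

lemma msqrt_eqI:
  assumes "psd B" "B ** B = A"
  shows "msqrt A = B"
  unfolding msqrt_def
  by (rule the_equality) (use assms psd_square_unique in auto)

lemma psd_msqrt:
  assumes "psd A"
  shows "psd (msqrt A)" "msqrt A ** msqrt A = A"
proof -
  obtain U \<mu> where U: "unitary U" "\<And>i. 0 \<le> \<mu> i" and A: "A = U ** diagm (\<lambda>i. complex_of_real (\<mu> i)) ** adj U"
    using psd_diagonalisation assms by blast
  define S where "S = diagm (\<lambda>i. complex_of_real (sqrt (\<mu> i)))"
  define B where "B = U ** S ** adj U"
  have "S ** S = diagm (\<lambda>i. complex_of_real (\<mu> i))"
    unfolding S_def adj_diagm diagm_mult_diagm using U(2)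
    by (auto simp: vec_eq_iff of_real_mult[symmetric] simp del: of_real_mult)
  moreover have "B ** B = U ** (S ** (adj U ** U) ** S) ** adj U"
    unfolding B_def by (simp only: matrix_mul_assoc)
  ultimately have 1: "B ** B = A" by (simp add: unitaryD U A)
  have 2: "psd B" unfolding B_def S_def by (rule psd_conj_diagm) (simp add: U)
  show "psd (msqrt A)" "msqrt A ** msqrt A = A"
    using msqrt_eqI[OF 2 1] 1 2 by auto
qed

text \<open>Polynomials with equal values everywhere are equal, and \<open>proots\<close> recovers
  the multiset from its product of linear factors. This gives the list described in
  \<open>eigs_desc\<close> its uniqueness.\<close>

lemma prod_linear_factors_unique:
  fixes M N :: "complex multiset"
  assumes "\<And>z. (\<Prod>x\<in>#M. z - x) = (\<Prod>x\<in>#N. z - x)"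
  shows "M = N"
proof -
  define p where "p = (\<lambda>M :: complex multiset. \<Prod>x\<in>#M. [:- x, 1:])"
  have nz: "p M \<noteq> 0" for M
    unfolding p_def by (subst prod_mset_zero_iff) auto
  have "poly (p M) z = (\<Prod>x\<in>#M. z - x)" for M z
    by (induction M) (auto simp: p_def algebra_simps)
  then have "poly (p M) = poly (p N)" using assms by auto
  then have "p M = p N" by (simp add: poly_eq_poly_eq_iff)
  moreover have "proots (p M) = M" for M
  proof (induction M)
    case (add x M)
    have "p (add_mset x M) = [:- x, 1:] * p M" by (simp add: p_def)
    moreover have "proots ([:- x, 1:] * p M) = proots [:- x, 1:] + proots (p M)"
      using nz by (intro proots_mult) auto
    ultimately show ?case using add by simp
  qed (simp add: p_def)
  ultimately show ?thesis by metis
qed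

lemma det_shift_unitary_conj:
  fixes U :: "complex^'n^'n"
  assumes "unitary U"
  shows "det (mat z - U ** diagm \<mu> ** adj U) = (\<Prod>i\<in>UNIV. z - \<mu> i)"
proof -
  have "U ** diagm (\<lambda>i. z - \<mu> i) ** adj U = U ** diagm (\<lambda>i. z) ** adj U - U ** diagm \<mu> ** adj U"
    by (simp add: vec_eq_iff matrix_mult_nth[of _ "adj U"] algebra_simps sum_subtractf)
  moreover have "U ** diagm (\<lambda>i. z) ** adj U = mat z"
  proof -
    have "U ** diagm (\<lambda>i. z) ** adj U = diagm (\<lambda>i. z) ** (U ** adj U)"
      by (simp add: vec_eq_iff matrix_mult_nth[of _ "adj U"] sum_distrib_left mult_ac)
    then show ?thesis using unitaryD(2)[OF assms] by (simp add: mat_eq_diagm[of z])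
  qed
  ultimately have "det (mat z - U ** diagm \<mu> ** adj U) = det (U ** diagm (\<lambda>i. z - \<mu> i) ** adj U)"
    by simp
  also have "\<dots> = det (diagm (\<lambda>i. z - \<mu> i)) * det (U ** adj U)"
    by (simp add: det_mul)
  also have "\<dots> = (\<Prod>i\<in>UNIV. z - \<mu> i)"
    using unitaryD(2)[OF assms] by (simp add: det_diagonal)
  finally show ?thesis .
qed

lemma poly_det: "poly (det (\<chi> i j. f i j)) s = det (\<chi> i j. poly (f i j) s)"
  for f :: "'n::finite \<Rightarrow> 'n \<Rightarrow> 'a::comm_ring_1 poly"
  by (simp add: det_def poly_sum poly_prod)

text \<open>For \<open>s\<close> beyond a bound on the operator norm of \<open>A\<close> the shifted
  map is injective. Consequently its determinant, as a polynomial in \<open>s\<close>, is nonzero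
  and can be cancelled.\<close>

lemma ex_det_shift_nonzero:
  fixes A :: "complex^'n^'n"
  shows "\<exists>s. det (mat s + A) \<noteq> 0"
proof -
  have "linear ((*v) A)"
    by (rule linearI) (auto simp: matrix_vector_mult_def vec_eq_iff algebra_simps sum.distrib scaleR_sum_right)
  then obtain K where K: "K > 0" "\<And>v. norm (A *v v) \<le> K * norm v"
    using linear_bounded_pos by blast
  define s where "s = complex_of_real (2 * K)"
  have "v = 0" if "(mat s + A) *v v = 0" for v
  proof -
    have "A *v v = - (mat s *v v)" using that by (simp add: matrix_vector_mult_add_rdistrib add_eq_0_iff)
    also have "mat s *v v = (2 * K) *\<^sub>R v"
      by (simp add: vec_eq_iff matrix_vector_mult_def mat_def s_def if_distrib[where f="\<lambda>x. x * _"]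
          scaleR_vec_nth_complex del: vector_scaleR_component cong: if_cong)
    finally have "2 * K * norm v \<le> K * norm v" using K(2)[of v] K(1) by simp
    then show ?thesis using K(1) by simp
  qed
  then have "\<exists>B. B ** (mat s + A) = mat 1" using matrix_left_invertible_ker by blast
  then have "invertible (mat s + A)"
    unfolding invertible_def using matrix_left_right_inverse by blast
  then show ?thesis using invertible_det_nz by blast
qed

text \<open>Cancelling \<open>det (s + A)\<close> is legitimate in the ring of polynomials in \<open>s\<close>, even if \<open>det A = 0\<close>.\<close>

lemma det_shift_commute:
  fixes A B :: "complex^'n^'n"
  shows "det (mat z - A ** B) = det (mat z - B ** A)"
proof -
  define P where "P = det (\<chi> i j. [:A $ i $ j, mat 1 $ i $ j:])"
  define F where "F = det (\<chi> i j. [:(mat z - A ** B) $ i $ j, - (B $ i $ j):])"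
  define G where "G = det (\<chi> i j. [:(mat z - B ** A) $ i $ j, - (B $ i $ j):])"
  have sB: "(mat s ** B) $ i $ j = s * B $ i $ j" "(B ** mat s) $ i $ j = s * B $ i $ j" for s i j
    by (simp_all add: mat_eq_diagm mult.commute)
  have P: "poly P s = det (mat s + A)" for s
    unfolding P_def poly_det by (rule arg_cong[where f=det]) (simp add: vec_eq_iff mat_def)
  have F: "poly F s = det (mat z - (mat s + A) ** B)" for s
    unfolding F_def poly_det
    by (rule arg_cong[where f=det]) (simp add: vec_eq_iff sB matrix_add_rdistrib)
  have G: "poly G s = det (mat z - B ** (mat s + A))" for s
    unfolding G_def poly_det
    by (rule arg_cong[where f=det]) (simp add: vec_eq_iff sB matrix_add_ldistrib)
  have "poly (F * P) s = poly (P * G) s" for s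
  proof -
    define X where "X = mat s + A"
    have c: "mat z ** X = X ** mat z"
      by (simp add: vec_eq_iff mat_eq_diagm mult.commute)
    \<comment> \<open>Both sides are \<open>z X - X B X\<close>; taking determinants proves the
      claim up to the factor \<open>det X\<close>.\<close>
    have "(mat z - X ** B) ** X = X ** (mat z - B ** X)"
      by (simp add: matrix_sub_ldistrib matrix_sub_rdistrib c matrix_mul_assoc)
    then have "det ((mat z - X ** B) ** X) = det (X ** (mat z - B ** X))" by simp
    then show ?thesis by (simp add: P F G det_mul X_def)
  qed
  then have "F * P = P * G" by (metis poly_eq_poly_eq_iff ext)
  moreover have "P \<noteq> 0" using ex_det_shift_nonzero[of A] P by fastforce
  ultimately have "F = G" by simp
  \<comment> \<open>At \<open>s = 0\<close> the shift disappears and the original matrices are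
    back.\<close>
  then have "poly F 0 = poly G 0" by simp
  then show ?thesis by (simp add: F G)
qed

lemma mset_set_eigenvalues_unique:
  fixes \<mu> \<nu> :: "'n::finite \<Rightarrow> real"
  assumes "\<And>z. (\<Prod>i\<in>UNIV. z - complex_of_real (\<mu> i)) = (\<Prod>i\<in>UNIV. z - complex_of_real (\<nu> i))"
  shows "image_mset \<mu> (mset_set UNIV) = image_mset \<nu> (mset_set UNIV)"
proof -
  have "image_mset complex_of_real (image_mset \<mu> (mset_set UNIV)) = image_mset complex_of_real (image_mset \<nu> (mset_set UNIV))"
    by (rule prod_linear_factors_unique)
      (use assms in \<open>simp add: prod_unfold_prod_mset multiset.map_comp o_def\<close>)
  then show ?thesis
    by (drule_tac arg_cong[where f="image_mset Re"]) (simp add: multiset.map_comp o_def)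
qed

lemma eigs_desc_eq:
  fixes R :: qqmat and \<mu> :: "2 \<times> 2 \<Rightarrow> real"
  assumes "unitary U" "R = U ** diagm (\<lambda>i. complex_of_real (\<mu> i)) ** adj U"
  shows "eigs_desc R = rev (sorted_list_of_multiset (image_mset \<mu> (mset_set UNIV)))"
  unfolding eigs_desc_def
proof (rule the_equality)
  define M where "M = image_mset \<mu> (mset_set (UNIV :: (2 \<times> 2) set))"
  have det: "det (mat z - R) = (\<Prod>x\<in>#M. z - complex_of_real x)" for z
    unfolding assms(2) det_shift_unitary_conj[OF assms(1)] M_def
    by (simp add: prod_unfold_prod_mset multiset.map_comp o_def)
  have pl: "(\<Prod>x\<leftarrow>l. z - complex_of_real x) = (\<Prod>x\<in>#mset l. z - complex_of_real x)" for l z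
    by (induction l) auto
  have "size M = 4" by (simp add: M_def)
  then show "length (rev (sorted_list_of_multiset (image_mset \<mu> (mset_set (UNIV :: (2 \<times> 2) set))))) = 4 \<and>
      sorted (rev (rev (sorted_list_of_multiset (image_mset \<mu> (mset_set (UNIV :: (2 \<times> 2) set)))))) \<and>
      (\<forall>z. det (mat z - R) =
         (\<Prod>x\<leftarrow>rev (sorted_list_of_multiset (image_mset \<mu> (mset_set (UNIV :: (2 \<times> 2) set)))). z - complex_of_real x))"
    unfolding M_def[symmetric] pl det
    by (metis mset_rev mset_sorted_list_of_multiset rev_rev_ident size_mset sorted_sorted_list_of_multiset)
  fix l assume l: "length l = 4 \<and> sorted (rev l) \<and> (\<forall>z. det (mat z - R) = (\<Prod>x\<leftarrow>l. z - complex_of_real x))"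
  have "image_mset complex_of_real (mset l) = image_mset complex_of_real M"
    by (rule prod_linear_factors_unique) (use l in \<open>simp add: multiset.map_comp o_def det pl\<close>)
  then have "mset l = M"
    by (drule_tac arg_cong[where f="image_mset Re"]) (simp add: multiset.map_comp o_def)
  then have "sorted_list_of_multiset M = rev l"
    using l by (metis mset_rev sorted_list_of_multiset_mset sorted_sort_id)
  then show "l = rev (sorted_list_of_multiset (image_mset \<mu> (mset_set (UNIV :: (2 \<times> 2) set))))"
    by (simp add: M_def)
qed

text \<open>The largest value minus all the others, written symmetrically so that no ordering of the
  index type is involved.\<close>

definition gap :: "('n::finite \<Rightarrow> real) \<Rightarrow> real" where
  "gap \<mu> = 2 * Max (range \<mu>) - (\<Sum>i\<in>UNIV. \<mu> i)"

lemma eigs_desc_gap: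
  fixes \<mu> :: "2 \<times> 2 \<Rightarrow> real"
  assumes "l = rev (sorted_list_of_multiset (image_mset \<mu> (mset_set UNIV)))"
  shows "l ! 0 - l ! 1 - l ! 2 - l ! 3 = gap \<mu>"
proof -
  define M where "M = image_mset \<mu> (mset_set (UNIV :: (2 \<times> 2) set))"
  have ml: "mset l = M" by (simp add: assms M_def)
  have sl: "sorted (rev l)" by (simp add: assms)
  have "length l = size M" by (simp add: ml[symmetric])
  then have "length l = 4" by (simp add: M_def)
  then obtain a b c d where l: "l = [a, b, c, d]"
    by (auto simp: numeral_eq_Suc length_Suc_conv)
  have "(\<Sum>i\<in>UNIV. \<mu> i) = sum_mset M" by (simp add: M_def sum_unfold_sum_mset)
  also have "\<dots> = a + b + c + d" using ml l by (metis sum_mset_sum_list sum_list_simps add.assoc add.right_neutral)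
  finally have 1: "(\<Sum>i\<in>UNIV. \<mu> i) = a + b + c + d" .
  have "range \<mu> = set_mset M" by (simp add: M_def)
  also have "\<dots> = {a, b, c, d}" using ml l by (metis set_mset_mset list.simps(15) list.set(1))
  finally have "range \<mu> = {a, b, c, d}" .
  moreover have "b \<le> a" "c \<le> a" "d \<le> a" using sl l by auto
  ultimately have "Max (range \<mu>) = a" by (simp add: max_def)
  then show ?thesis using 1 l by (simp add: gap_def)
qed

section \<open>The concurrence as a gap of singular values\<close>

lemma two_cases: "(i::2) = 0 \<or> i = 1"
  using exhaust_2[of i] by auto

lemma UNIV_two: "(UNIV :: 2 set) = {0, 1}"
  using two_cases by auto

lemma all_two: "(\<forall>i::2. P i) \<longleftrightarrow> P 0 \<and> P 1"
  using two_cases by metis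

lemma sum_two: "(\<Sum>i\<in>(UNIV::2 set). f i) = f 0 + f 1"
  by (simp add: UNIV_two)

lemma UNIV_two_times_two: "(UNIV :: (2 \<times> 2) set) = {(0,0), (0,1), (1,0), (1,1)}"
  using two_cases by auto

lemma sum_two_times_two:
  "(\<Sum>i\<in>(UNIV::(2\<times>2) set). f i) = f (0,0) + f (0,1) + f (1,0) + f (1,1)"
  by (simp add: UNIV_two_times_two add.assoc)

lemma kron_nth: "kron A B $ p $ q = A $ fst p $ fst q * B $ snd p $ snd q"
  by (simp add: kron_def)

lemma kron_mult: "kron A B ** kron C D = kron (A ** C) (B ** D)"
  unfolding vec_eq_iff kron_nth matrix_mult_nth sum_two sum_two_times_two
  by (simp add: algebra_simps)

lemma adj_kron: "adj (kron A B) = kron (adj A) (adj B)"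
  by (simp add: vec_eq_iff kron_nth)

lemma transpose_kron: "transpose (kron A B) = kron (transpose A) (transpose B)"
  by (simp add: vec_eq_iff kron_nth transpose_def)

lemma kron_mat: "kron (mat 1) (mat 1) = mat 1"
  by (auto simp: vec_eq_iff kron_nth mat_def prod_eq_iff)

lemma unitary_kron: "unitary A \<Longrightarrow> unitary B \<Longrightarrow> unitary (kron A B)"
  by (simp add: unitary_def adj_kron kron_mult kron_mat)

abbreviation YY :: qqmat where "YY \<equiv> kron pauliY pauliY"

lemma pauliY_nth [simp]: "pauliY $ 0 $ 0 = 0" "pauliY $ 0 $ 1 = - \<i>"
  "pauliY $ 1 $ 0 = \<i>" "pauliY $ 1 $ 1 = 0"
  by (simp_all add: pauliY_def)

lemma YY_simps [simp]: "conjm YY = YY" "adj YY = YY" "transpose YY = YY"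
  by (simp_all add: vec_eq_iff kron_nth all_two transpose_def)

text \<open>The squared eigenvalues of \<open>R\<close> are those of
  \<open>P ** \<rho>t ** P\<close>. Exchanging factors twice carries this spectrum to
  \<open>\<rho>t ** \<rho>\<close> and then to \<open>adj W ** \<rho>t ** W\<close>, which is
  \<open>conjm (diagm \<mu>) ** diagm \<mu>\<close>. Since any factor \<open>W\<close> of \<rho> is
  allowed, the concurrence of a concrete state can be read off an explicit one.\<close>

lemma concurrence_eq_gap:
  assumes \<rho>: "\<rho> = W ** adj W" and W: "transpose W ** YY ** W = diagm \<mu>"
  shows "concurrence \<rho> = max 0 (gap (\<lambda>i. cmod (\<mu> i)))"
proof -
  define P where "P = msqrt \<rho>"
  have "psd \<rho>" unfolding \<rho> by (rule psd_mult_adj)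
  then have P: "psd P" "P ** P = \<rho>" unfolding P_def by (auto intro: psd_msqrt)
  then have adjP: "adj P = P" by (simp add: psd_def hermitian_def)
  define \<rho>t where "\<rho>t = YY ** conjm \<rho> ** YY"
  define G where "G = YY ** conjm W"
  have adjG: "adj G = transpose W ** YY"
    by (simp add: G_def adj_mult adj_conjm transpose_eq_conjm_adj)
  have G: "\<rho>t = G ** adj G"
    unfolding adjG by (simp only: G_def \<rho>t_def \<rho> conjm_mult transpose_eq_conjm_adj matrix_mul_assoc)
  define M where "M = P ** \<rho>t ** P"
  have "M = (P ** G) ** adj (P ** G)"
    unfolding M_def G adj_mult adjP by (simp only: matrix_mul_assoc)
  then have "psd M" by (simp add: psd_mult_adj)
  define R where "R = msqrt M"
  have R: "psd R" "R ** R = M" unfolding R_def using \<open>psd M\<close> by (auto intro: psd_msqrt)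
  obtain U \<nu> where U: "unitary U" "\<And>i. 0 \<le> \<nu> i" and RU: "R = U ** diagm (\<lambda>i. complex_of_real (\<nu> i)) ** adj U"
    using psd_diagonalisation R(1) by blast
  define D where "D = diagm (\<lambda>i. complex_of_real (\<nu> i))"
  have "M = U ** (D ** (adj U ** U) ** D) ** adj U"
    unfolding R(2)[symmetric] RU D_def by (simp only: matrix_mul_assoc)
  then have MU: "M = U ** diagm (\<lambda>i. complex_of_real ((\<nu> i)\<^sup>2)) ** adj U"
    by (simp add: unitaryD U D_def diagm_mult_diagm power2_eq_square)
  have "adj W ** \<rho>t ** W = (adj W ** YY ** conjm W) ** (transpose W ** YY ** W)"
    unfolding G adjG by (simp only: G_def matrix_mul_assoc)
  also have "adj W ** YY ** conjm W = conjm (transpose W ** YY ** W)"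
    by (simp add: conjm_mult transpose_eq_conjm_adj)
  also have "conjm (transpose W ** YY ** W) ** (transpose W ** YY ** W) = diagm (\<lambda>i. complex_of_real ((cmod (\<mu> i))\<^sup>2))"
  proof -
    have "cnj (\<mu> i) * \<mu> i = complex_of_real ((cmod (\<mu> i))\<^sup>2)" for i
      by (simp only: complex_norm_square mult.commute)
    moreover have "conjm (diagm \<mu>) = diagm (\<lambda>i. cnj (\<mu> i))"
      by (auto simp: vec_eq_iff)
    ultimately show ?thesis unfolding W by (simp only: diagm_mult_diagm)
  qed
  finally have WW: "adj W ** \<rho>t ** W = diagm (\<lambda>i. complex_of_real ((cmod (\<mu> i))\<^sup>2))" .
  have "(\<Prod>i\<in>UNIV. z - complex_of_real ((\<nu> i)\<^sup>2)) = (\<Prod>i\<in>UNIV. z - complex_of_real ((cmod (\<mu> i))\<^sup>2))" for z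
  proof -
    have "(\<Prod>i\<in>UNIV. z - complex_of_real ((\<nu> i)\<^sup>2)) = det (mat z - P ** (\<rho>t ** P))"
      unfolding det_shift_unitary_conj[OF U(1), symmetric] MU[symmetric] M_def by (simp only: matrix_mul_assoc)
    also have "\<dots> = det (mat z - (\<rho>t ** P) ** P)" by (rule det_shift_commute)
    also have "(\<rho>t ** P) ** P = (\<rho>t ** W) ** adj W"
      by (simp add: matrix_mul_assoc[symmetric] P(2)) (simp add: \<rho>)
    also have "det (mat z - (\<rho>t ** W) ** adj W) = det (mat z - adj W ** (\<rho>t ** W))"
      by (rule det_shift_commute)
    also have "adj W ** (\<rho>t ** W) = mat 1 ** diagm (\<lambda>i. complex_of_real ((cmod (\<mu> i))\<^sup>2)) ** adj (mat 1)"
      using WW by (simp add: matrix_mul_assoc)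
    also have "det (mat z - \<dots>) = (\<Prod>i\<in>UNIV. z - complex_of_real ((cmod (\<mu> i))\<^sup>2))"
      by (rule det_shift_unitary_conj) simp
    finally show ?thesis .
  qed
  then have "image_mset (\<lambda>i. (\<nu> i)\<^sup>2) (mset_set UNIV) = image_mset (\<lambda>i. (cmod (\<mu> i))\<^sup>2) (mset_set UNIV)"
    by (rule mset_set_eigenvalues_unique)
  then have "image_mset sqrt (image_mset (\<lambda>i. (\<nu> i)\<^sup>2) (mset_set UNIV)) =
     image_mset sqrt (image_mset (\<lambda>i. (cmod (\<mu> i))\<^sup>2) (mset_set UNIV))" by simp
  then have "image_mset \<nu> (mset_set UNIV) = image_mset (\<lambda>i. cmod (\<mu> i)) (mset_set UNIV)"
    by (simp add: multiset.map_comp o_def U)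
  then have "eigs_desc R = rev (sorted_list_of_multiset (image_mset (\<lambda>i. cmod (\<mu> i)) (mset_set UNIV)))"
    using eigs_desc_eq[OF U(1) RU] by simp
  from eigs_desc_gap[OF this] show ?thesis
    unfolding concurrence_def Let_def R_def M_def \<rho>t_def P_def by simp
qed

lemma ex_wootters_factorisation:
  assumes "psd \<rho>"
  obtains W \<mu> where "\<rho> = W ** adj W" "\<And>i. 0 \<le> \<mu> i"
    "transpose W ** YY ** W = diagm (\<lambda>i. complex_of_real (\<mu> i))"
proof -
  define P where "P = msqrt \<rho>"
  have P: "psd P" "P ** P = \<rho>" unfolding P_def using assms by (auto intro: psd_msqrt)
  then have adjP: "adj P = P" by (simp add: psd_def hermitian_def)
  have "transpose (transpose P ** YY ** P) = transpose P ** YY ** P"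
    by (simp add: matrix_transpose_mul matrix_mul_assoc)
  then obtain V \<nu> where V: "unitary V"
    "transpose V ** (transpose P ** YY ** P) ** V = diagm (\<lambda>i. complex_of_real (\<nu> i))"
    using takagi_factorisation by blast
  \<comment> \<open>A column phase enters the symmetric form squared, so \<open>\<i>\<close> flips
    the sign of a negative diagonal entry.\<close>
  define u where "u = (\<lambda>i. if \<nu> i < 0 then \<i> else 1)"
  define W where "W = P ** V ** diagm u"
  have u: "unitary (diagm u)" by (rule unitary_diagm) (simp add: u_def)
  have "W ** adj W = P ** (V ** (diagm u ** adj (diagm u)) ** adj V) ** adj P"
    unfolding W_def adj_mult by (simp only: matrix_mul_assoc)
  then have 1: "\<rho> = W ** adj W" using P(2) by (simp add: unitaryD V u adjP)
  have "transpose W ** YY ** W = transpose (diagm u) ** (transpose V ** (transpose P ** YY ** P) ** V) ** diagm u"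
    unfolding W_def matrix_transpose_mul by (simp only: matrix_mul_assoc)
  also have "transpose (diagm u) = diagm u" by (auto simp: vec_eq_iff transpose_def)
  also have "diagm u ** (transpose V ** (transpose P ** YY ** P) ** V) ** diagm u = diagm (\<lambda>i. complex_of_real \<bar>\<nu> i\<bar>)"
    unfolding V(2) by (auto simp: vec_eq_iff diagm_mult_diagm u_def complex_eq_iff)
  finally show ?thesis using 1 that[of W "\<lambda>i. \<bar>\<nu> i\<bar>"] by simp
qed

section \<open>Wootters' decomposition\<close>

lemma triangle_closes:
  fixes a b r :: real
  assumes "0 \<le> a" "0 \<le> b" "0 \<le> r" "\<bar>a - b\<bar> \<le> r" "r \<le> a + b"
  shows "\<exists>(u::complex) (v::complex). cmod u = 1 \<and> cmod v = 1 \<and> a * u + b * v = r"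
proof -
  consider "a = 0" | "r = 0" | "b = 0" | "0 < a" "0 < b" "0 < r" using assms by force
  then show ?thesis
  proof cases
    case 1
    then show ?thesis using assms by (intro exI[of _ 1] exI[of _ 1]) auto
  next
    case 2
    then show ?thesis using assms by (intro exI[of _ 1] exI[of _ "-1"]) auto
  next
    case 3
    then show ?thesis using assms by (intro exI[of _ 1] exI[of _ 1]) auto
  next
    case 4
    \<comment> \<open>Law of cosines: the cosine of the angle between the sides \<open>a\<close> and
      \<open>r\<close> of a triangle whose third side is \<open>b\<close>.\<close>
    define c where "c = (a\<^sup>2 + r\<^sup>2 - b\<^sup>2) / (2 * a * r)"
    have "(a - r)\<^sup>2 \<le> b\<^sup>2" "b\<^sup>2 \<le> (a + r)\<^sup>2"
      using assms by (auto simp: abs_le_square_iff[symmetric])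
    then have "- 1 \<le> c" "c \<le> 1"
      using 4 unfolding c_def by (auto simp: field_simps power2_eq_square)
    then have c2: "c\<^sup>2 \<le> 1" by (simp add: abs_square_le_1 abs_le_iff)
    define u where "u = Complex c (sqrt (1 - c\<^sup>2))"
    define v where "v = (r - a * u) / b"
    have u: "cmod u = 1" using c2 by (simp add: u_def cmod_def)
    have "2 * a * r * c = a\<^sup>2 + r\<^sup>2 - b\<^sup>2" using 4 by (simp add: c_def)
    then have "(r - a * c)\<^sup>2 + a\<^sup>2 * (1 - c\<^sup>2) = b\<^sup>2"
      by (simp add: power2_eq_square algebra_simps)
    then have "(cmod (r - a * u))\<^sup>2 = b\<^sup>2"
      using c2 by (simp add: cmod_power2 u_def power_mult_distrib)
    then have "cmod (r - a * u) = b" using 4 by (simp add: power2_eq_iff_nonneg)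
    then have "cmod v = 1" using 4 by (simp add: v_def norm_divide)
    moreover have "a * u + b * v = r" using 4 by (simp add: v_def)
    ultimately show ?thesis using u by blast
  qed
qed

text \<open>A nonpositive gap says that no side is longer than the other three together, so four
  such lengths bound a closed quadrilateral, which is built from two triangles sharing a
  diagonal.\<close>

lemma quadrilateral_closes:
  fixes \<mu> :: "2 \<times> 2 \<Rightarrow> real"
  assumes nn: "\<And>i. 0 \<le> \<mu> i" and "gap \<mu> \<le> 0"
  shows "\<exists>u. (\<forall>i. cmod (u i) = 1) \<and> (\<Sum>i\<in>UNIV. (u i)\<^sup>2 * \<mu> i) = 0"
proof -
  define a b c d where "a = \<mu> (0,0)" "b = \<mu> (0,1)" "c = \<mu> (1,0)" "d = \<mu> (1,1)"
  note defs = this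
  have nn': "0 \<le> a" "0 \<le> b" "0 \<le> c" "0 \<le> d" using nn defs by auto
  have "2 * \<mu> i \<le> a + b + c + d" for i
  proof -
    have "\<mu> i \<le> Max (range \<mu>)" by simp
    then show ?thesis using assms(2) unfolding gap_def sum_two_times_two defs by linarith
  qed
  from this[of "(0,0)"] this[of "(0,1)"] this[of "(1,0)"] this[of "(1,1)"]
  have le: "a \<le> b + c + d" "b \<le> a + c + d" "c \<le> a + b + d" "d \<le> a + b + c"
    by (simp_all flip: defs)
  \<comment> \<open>The common diagonal, of the smallest length that both triangles admit.\<close>
  define r where "r = max \<bar>a - b\<bar> \<bar>c - d\<bar>"
  have r: "0 \<le> r" "\<bar>a - b\<bar> \<le> r" "r \<le> a + b" "\<bar>c - d\<bar> \<le> r" "r \<le> c + d"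
    using nn' le by (auto simp: r_def max_def abs_if split: if_splits)
  obtain u1 u2 :: complex where 1: "cmod u1 = 1" "cmod u2 = 1" "a * u1 + b * u2 = r"
    using triangle_closes[OF nn'(1,2) r(1-3)] by blast
  obtain u3 u4 :: complex where 2: "cmod u3 = 1" "cmod u4 = 1" "c * u3 + d * u4 = r"
    using triangle_closes[OF nn'(3,4) r(1,4,5)] by blast
  \<comment> \<open>The second triangle is traversed backwards, so the two copies of the diagonal
    cancel. Since the phases occur squared in the claim, square roots of \<open>v\<close> are the
    witnesses.\<close>
  define v where "v = (\<lambda>i :: 2 \<times> 2. if i = (0,0) then u1 else if i = (0,1) then u2
     else if i = (1,0) then - u3 else - u4)"
  have "cmod (v i) = 1" for i using 1 2 by (simp add: v_def)
  then have "cmod (csqrt (v i)) = 1" for i by simp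
  moreover have "(\<Sum>i\<in>UNIV. (csqrt (v i))\<^sup>2 * \<mu> i) = 0"
  proof -
    have "(\<Sum>i\<in>UNIV. (csqrt (v i))\<^sup>2 * \<mu> i) = (a * u1 + b * u2) - (c * u3 + d * u4)"
      by (simp add: sum_two_times_two v_def flip: defs)
    then show ?thesis using 1 2 by simp
  qed
  ultimately show ?thesis by (intro exI[of _ "\<lambda>i. csqrt (v i)"]) simp
qed

text \<open>The tensor square of the normalised 2 by 2 Hadamard matrix. All its entries have the
  same square, so congruence with it replaces every diagonal entry of a diagonal matrix by their
  average.\<close>

definition hadamard :: "real^(2\<times>2)^(2\<times>2)" where
  "hadamard = (\<chi> p q. 1 / 2 * (if fst p = 1 \<and> fst q = 1 then -1 else 1)
                         * (if snd p = 1 \<and> snd q = 1 then -1 else 1))"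

lemma hadamard_orthogonal: "transpose hadamard ** hadamard = mat 1"
  by (simp add: vec_eq_iff all_two matrix_mult_nth sum_two_times_two hadamard_def transpose_def mat_def)

lemma hadamard_square: "hadamard $ i $ j * hadamard $ i $ j = 1 / 4"
  by (simp add: hadamard_def)

lemma transpose_conj_diagm_nth:
  "(transpose A ** diagm d ** A) $ i $ i = (\<Sum>j\<in>UNIV. A $ j $ i * A $ j $ i * d j)"
  for A :: "'a::comm_semiring_1^'n^'m"
  by (simp add: matrix_mult_nth[of _ A] transpose_def mult_ac)

lemma matrix_mult3_nth:
  "(A ** B ** C) $ i $ l = (\<Sum>k\<in>UNIV. \<Sum>j\<in>UNIV. A $ i $ j * B $ j $ k * C $ k $ l)"
  by (simp add: matrix_mult_nth sum_distrib_right)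

text \<open>For \<open>C > 0\<close> the phases give the dominant singular value the opposite sign to the others; a real
  rotation then spreads the traceless real quadratic form \<open>tangle - C * norm\<^sup>2\<close> evenly, so that it
  vanishes on every column. For \<open>C = 0\<close> the phases make the trace of the (complex) form vanish.\<close>

lemma wootters_decomposition:
  assumes "density \<rho>"
  obtains Z where "\<rho> = Z ** adj Z"
    "\<And>i. cmod ((transpose Z ** YY ** Z) $ i $ i) = concurrence \<rho> * Re ((adj Z ** Z) $ i $ i)"
proof -
  define C where "C = concurrence \<rho>"
  obtain W \<mu> where \<rho>: "\<rho> = W ** adj W" and nn: "\<And>i. 0 \<le> \<mu> i"
    and W: "transpose W ** YY ** W = diagm (\<lambda>i. complex_of_real (\<mu> i))"
    using ex_wootters_factorisation assms unfolding density_def by blast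
  have C: "C = max 0 (gap \<mu>)"
    using concurrence_eq_gap[OF \<rho> W] nn by (simp add: C_def)
  define cm where "cm = (\<lambda>A :: real^(2\<times>2)^(2\<times>2). \<chi> i j. complex_of_real (A $ i $ j))"
  \<comment> \<open>Phases alter the diagonal form by \<open>u\<^sup>2\<close>, after which the real
    rotation \<open>Q\<close> acts on it by congruence; both preserve the product
    \<open>W ** adj W\<close>.\<close>
  define E where "E = (\<lambda>u Q. diagm u ** cm Q)"
  have E_unitary: "unitary (E u Q)" if u: "\<And>i. cmod (u i) = 1" and Q: "transpose Q ** Q = mat 1" for u Q
  proof -
    have "adj (cm Q) ** cm Q = cm (transpose Q ** Q)"
      by (simp add: vec_eq_iff matrix_mult_nth cm_def transpose_def)
    also have "\<dots> = mat 1" unfolding Q by (simp add: cm_def mat_def vec_eq_iff)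
    finally show ?thesis
      unfolding E_def by (intro unitary_mult unitary_diagm u) (simp add: unitary_iff)
  qed
  have decomp: "\<rho> = (W ** E u Q) ** adj (W ** E u Q)" if "unitary (E u Q)" for u Q
  proof -
    have "(W ** E u Q) ** adj (W ** E u Q) = W ** (E u Q ** adj (E u Q)) ** adj W"
      unfolding adj_mult by (simp only: matrix_mul_assoc)
    then show ?thesis using that by (simp add: unitaryD \<rho>)
  qed
  have tangle: "(transpose (W ** E u Q) ** YY ** (W ** E u Q)) $ i $ i =
      (\<Sum>j\<in>UNIV. (Q $ j $ i * Q $ j $ i) * ((u j)\<^sup>2 * \<mu> j))" for u :: "2 \<times> 2 \<Rightarrow> complex" and Q i
  proof -
    have "transpose (W ** E u Q) ** YY ** (W ** E u Q) = transpose (E u Q) ** (transpose W ** YY ** W) ** E u Q"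
      by (simp only: matrix_transpose_mul matrix_mul_assoc)
    then show ?thesis
      by (simp only: W transpose_conj_diagm_nth) (simp add: E_def cm_def power2_eq_square mult_ac)
  qed
  show ?thesis
  proof (cases "gap \<mu> \<le> 0")
    case True
    then have "C = 0" by (simp add: C)
    obtain u where u: "\<And>i. cmod (u i) = 1" "(\<Sum>i\<in>UNIV. (u i)\<^sup>2 * \<mu> i) = 0"
      using quadrilateral_closes[of \<mu>] nn True by blast
    define Z where "Z = W ** E u hadamard"
    have "(transpose Z ** YY ** Z) $ i $ i = (\<Sum>j\<in>UNIV. (u j)\<^sup>2 * \<mu> j) / 4" for i
      unfolding Z_def tangle hadamard_square by (simp add: sum_divide_distrib)
    then have "cmod ((transpose Z ** YY ** Z) $ i $ i) = concurrence \<rho> * Re ((adj Z ** Z) $ i $ i)" for i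
      using u \<open>C = 0\<close> by (simp add: C_def)
    moreover have "\<rho> = Z ** adj Z"
      unfolding Z_def by (intro decomp E_unitary u hadamard_orthogonal)
    ultimately show ?thesis using that by blast
  next
    case False
    then have Cg: "C = gap \<mu>" by (simp add: C)
    have "Max (range \<mu>) \<in> range \<mu>" by (rule Max_in) auto
    then obtain m where m: "Max (range \<mu>) = \<mu> m" by (rule imageE)
    define u where "u = (\<lambda>i. if i = m then 1 else \<i>)"
    \<comment> \<open>The values after the phases: all but the largest are negated, which makes
      their sum the gap.\<close>
    define \<epsilon> where "\<epsilon> = (\<lambda>i. (if i = m then 1 else - 1) * \<mu> i)"
    have u: "cmod (u i) = 1" "(u i)\<^sup>2 * \<mu> i = complex_of_real (\<epsilon> i)" for i
      by (simp_all add: u_def \<epsilon>_def)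
    have "\<epsilon> i = (if i = m then 2 * \<mu> m else 0) - \<mu> i" for i by (simp add: \<epsilon>_def)
    then have sum_\<epsilon>: "(\<Sum>i\<in>UNIV. \<epsilon> i) = C"
      by (simp add: sum_subtractf Cg gap_def m)
    define X where "X = W ** diagm u"
    \<comment> \<open>Congruence with a real matrix commutes with taking real parts, so the real
      part of the Gram matrix determines the weights of the rotated columns.\<close>
    define G where "G = (\<chi> j k. Re ((adj X ** X) $ j $ k))"
    have "trace (adj X ** X) = trace (X ** adj X)" by (rule trace_mul_sym)
    also have "X ** adj X = W ** (diagm u ** adj (diagm u)) ** adj W"
      unfolding X_def adj_mult by (simp only: matrix_mul_assoc)
    also have "\<dots> = \<rho>"
    proof -
      have "unitary (diagm u)" by (rule unitary_diagm) (rule u)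
      then show ?thesis by (simp add: unitaryD \<rho>)
    qed
    finally have "trace (adj X ** X) = 1" using assms by (simp add: density_def)
    then have trG: "(\<Sum>j\<in>UNIV. G $ j $ j) = 1"
      by (simp add: trace_def G_def flip: Re_sum)
    \<comment> \<open>On a column of \<open>Q\<close> this form is the tangle minus \<open>C\<close>
      times the squared norm of the resulting column of \<open>Z\<close>. It is traceless because
      \<epsilon> sums to \<open>C\<close> and \<open>G\<close> has trace one.\<close>
    define K where "K = diagm \<epsilon> - C *\<^sub>R G"
    have "G $ j $ k = G $ k $ j" for j k
      by (simp add: G_def matrix_mult_nth mult.commute)
    then have "transpose K = K"
      by (simp add: vec_eq_iff transpose_def K_def)
    then obtain Q' :: "real^(2\<times>2)^(2\<times>2)" and \<kappa> where Q': "transpose Q' ** Q' = mat 1" "transpose Q' ** K ** Q' = diagm \<kappa>"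
      by (rule real_symmetric_diagonalisation)
    have "(\<Sum>j\<in>UNIV. \<kappa> j) = trace (transpose Q' ** (K ** Q'))"
      using Q'(2) by (simp add: trace_def matrix_mul_assoc)
    also have "\<dots> = trace (K ** (Q' ** transpose Q'))"
      by (subst trace_mul_sym) (simp only: matrix_mul_assoc)
    also have "Q' ** transpose Q' = mat 1" using Q'(1) by (simp add: matrix_left_right_inverse)
    also have "trace (K ** mat 1) = 0"
      by (simp add: trace_def K_def sum_subtractf sum_\<epsilon> trG flip: sum_distrib_left)
    finally have \<kappa>0: "(\<Sum>j\<in>UNIV. \<kappa> j) = 0" .
    \<comment> \<open>First diagonalise \<open>K\<close>, then average: every diagonal entry becomes
      a quarter of the trace, which is zero.\<close>
    define Q where "Q = Q' ** hadamard"
    have "transpose Q ** Q = transpose hadamard ** (transpose Q' ** Q') ** hadamard"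
      unfolding Q_def matrix_transpose_mul by (simp only: matrix_mul_assoc)
    then have OO: "transpose Q ** Q = mat 1" by (simp add: Q'(1) hadamard_orthogonal)
    have "transpose Q ** K ** Q = transpose hadamard ** (transpose Q' ** K ** Q') ** hadamard"
      unfolding Q_def matrix_transpose_mul by (simp only: matrix_mul_assoc)
    then have zero: "(transpose Q ** K ** Q) $ i $ i = 0" for i
      by (simp add: Q'(2) transpose_conj_diagm_nth hadamard_square \<kappa>0 flip: sum_divide_distrib)
    have zero': "(\<Sum>j\<in>UNIV. Q $ j $ i * Q $ j $ i * \<epsilon> j) = C * (transpose Q ** G ** Q) $ i $ i" for i
    proof -
      have "transpose Q ** K ** Q = transpose Q ** diagm \<epsilon> ** Q - C *\<^sub>R (transpose Q ** G ** Q)"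
        unfolding K_def
        by (simp add: matrix_sub_ldistrib matrix_sub_rdistrib scalar_matrix_assoc matrix_scalar_ac)
      moreover have "(transpose Q ** diagm \<epsilon> ** Q) $ i $ i = (\<Sum>j\<in>UNIV. Q $ j $ i * Q $ j $ i * \<epsilon> j)"
        by (rule transpose_conj_diagm_nth)
      ultimately show ?thesis using zero[of i] by simp
    qed
    define Z where "Z = W ** E u Q"
    have gram: "Re ((adj Z ** Z) $ i $ i) = (transpose Q ** G ** Q) $ i $ i" for i
    proof -
      have "adj Z ** Z = adj (cm Q) ** (adj X ** X) ** cm Q"
        unfolding Z_def E_def X_def adj_mult by (simp only: matrix_mul_assoc)
      then show ?thesis
        by (simp only: matrix_mult3_nth) (simp add: cm_def G_def transpose_def)
    qed
    have "(transpose Z ** YY ** Z) $ i $ i = complex_of_real (\<Sum>j\<in>UNIV. Q $ j $ i * Q $ j $ i * \<epsilon> j)" for i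
      unfolding Z_def tangle u(2) by simp
    then have "(transpose Z ** YY ** Z) $ i $ i = complex_of_real (C * Re ((adj Z ** Z) $ i $ i))" for i
      by (simp only: zero' gram)
    moreover have "0 \<le> Re ((adj Z ** Z) $ i $ i)" for i
      by (simp add: matrix_mult_nth sum_nonneg)
    moreover have "0 \<le> C" by (simp add: C)
    ultimately have "cmod ((transpose Z ** YY ** Z) $ i $ i) = concurrence \<rho> * Re ((adj Z ** Z) $ i $ i)" for i
      unfolding C_def by (simp add: norm_mult)
    moreover have "\<rho> = Z ** adj Z"
      unfolding Z_def by (intro decomp E_unitary u OO)
    ultimately show ?thesis using that by blast
  qed
qed

section \<open>Correlations of pure states\<close>

definition expect :: "qqmat \<Rightarrow> qmat \<Rightarrow> qmat \<Rightarrow> real" where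
  "expect \<rho> A B = Re (trace (\<rho> ** kron A B))"

definition sigma :: "3 \<Rightarrow> qmat" where
  "sigma i = dot_sigma (axis i 1)"

definition corr :: "qqmat \<Rightarrow> real^3^3" where
  "corr \<rho> = (\<chi> i j. expect \<rho> (sigma i) (sigma j))"

text \<open>The Bloch vector of the second qubit. That side is the relevant one because the columns
  of \<open>corr\<close>, whose Gram matrix is computed below, are indexed by the observables of the
  second qubit.\<close>

definition bloch :: "qqmat \<Rightarrow> real^3" where
  "bloch \<rho> = (\<chi> j. expect \<rho> (mat 1) (sigma j))"

lemma trace_kron: "trace (\<rho> ** kron A B) =
   (\<Sum>p\<in>UNIV. \<Sum>q\<in>UNIV. \<rho> $ p $ q * (A $ fst q $ fst p * B $ snd q $ snd p))"
  by (simp add: trace_def matrix_mult_nth kron_nth)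

lemma expect_add_left: "expect \<rho> (A + A') B = expect \<rho> A B + expect \<rho> A' B"
  by (simp add: expect_def trace_kron algebra_simps sum.distrib)

lemma expect_add_right: "expect \<rho> A (B + B') = expect \<rho> A B + expect \<rho> A B'"
  by (simp add: expect_def trace_kron algebra_simps sum.distrib)

lemma expect_scaleR_left: "expect \<rho> (r *\<^sub>R A) B = r * expect \<rho> A B"
proof -
  have "trace (\<rho> ** kron (r *\<^sub>R A) B) = complex_of_real r * trace (\<rho> ** kron A B)"
    unfolding trace_kron sum_distrib_left
    by (intro sum.cong refl) (simp add: scaleR_conv_of_real[where 'a=complex])
  then show ?thesis by (simp add: expect_def)
qed

lemma expect_scaleR_right: "expect \<rho> A (r *\<^sub>R B) = r * expect \<rho> A B"
proof -
  have "trace (\<rho> ** kron A (r *\<^sub>R B)) = complex_of_real r * trace (\<rho> ** kron A B)"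
    unfolding trace_kron sum_distrib_left
    by (intro sum.cong refl) (simp add: scaleR_conv_of_real[where 'a=complex])
  then show ?thesis by (simp add: expect_def)
qed

lemma axis_three [simp]: "axis (i::3) (1::real) $ j = (if i = j then 1 else 0)"
  by (simp add: axis_def)

lemma sigma_simps: "sigma 1 = pauliX" "sigma 2 = pauliY" "sigma 3 = pauliZ"
  by (simp_all add: sigma_def dot_sigma_def)

lemma dot_sigma_add: "dot_sigma (a + b) = dot_sigma a + dot_sigma b"
  by (simp add: dot_sigma_def scaleR_add_left)

lemma dot_sigma_diff: "dot_sigma (a - b) = dot_sigma a - dot_sigma b"
  by (simp add: dot_sigma_def scaleR_diff_left)

lemma expect_dot_sigma: "expect \<rho> (dot_sigma a) (dot_sigma b) = a \<bullet> (corr \<rho> *v b)"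
  unfolding dot_sigma_def
  by (simp add: expect_add_left expect_add_right expect_scaleR_left expect_scaleR_right
      inner_vec_def matrix_vector_mult_def sum_3 corr_def sigma_simps algebra_simps)

lemma pauli_nth [simp]:
  "pauliX $ 0 $ 0 = 0" "pauliX $ 0 $ 1 = 1" "pauliX $ 1 $ 0 = 1" "pauliX $ 1 $ 1 = 0"
  "pauliZ $ 0 $ 0 = 1" "pauliZ $ 0 $ 1 = 0" "pauliZ $ 1 $ 0 = 0" "pauliZ $ 1 $ 1 = -1"
  by (simp_all add: pauliX_def pauliZ_def)

lemma proj_nth: "proj z $ p $ q = z $ p * cnj (z $ q)"
  by (simp add: proj_def)

text \<open>The bilinear (not sesquilinear) form of \<open>YY\<close> at \<open>z\<close>, written
  out; its modulus is the concurrence of the unnormalised pure state.\<close>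

definition tangle :: "qqvec \<Rightarrow> complex" where
  "tangle z = 2 * (z $ (0,1) * z $ (1,0) - z $ (0,0) * z $ (1,1))"

lemma tangle_column: "(transpose Z ** YY ** Z) $ i $ i = tangle (column i Z)"
  by (simp add: matrix_mult_nth sum_two_times_two kron_nth transpose_def tangle_def column_def algebra_simps)

definition nrm2 :: "complex^'n \<Rightarrow> real" where
  "nrm2 z = (\<Sum>k\<in>UNIV. (cmod (z $ k))\<^sup>2)"

lemma nrm2_column: "Re ((adj Z ** Z) $ i $ i) = nrm2 (column i Z)"
  by (simp add: matrix_mult_nth nrm2_def column_def cmod_power2) (simp add: power2_eq_square)

text \<open>This plays the role of the Schmidt decomposition: the correlation matrix has singular values
  \<open>n, c, c\<close>, the first one in the direction of the Bloch vector.\<close>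

lemma pure_corr_gram:
  fixes z :: qqvec
  defines "T \<equiv> corr (proj z)" and "\<beta> \<equiv> bloch (proj z)"
  shows "(\<Sum>i\<in>UNIV. T $ i $ j * T $ i $ k) = (if j = k then (cmod (tangle z))\<^sup>2 else 0) + \<beta> $ j * \<beta> $ k"
    and "(nrm2 z)\<^sup>2 = (cmod (tangle z))\<^sup>2 + \<beta> \<bullet> \<beta>"
proof -
  \<comment> \<open>In real coordinates all claims become polynomial identities in eight
    variables.\<close>
  define p1 q1 p2 q2 p3 q3 p4 q4 where
    "p1 = Re (z $ (0,0))" "q1 = Im (z $ (0,0))" "p2 = Re (z $ (0,1))" "q2 = Im (z $ (0,1))"
    "p3 = Re (z $ (1,0))" "q3 = Im (z $ (1,0))" "p4 = Re (z $ (1,1))" "q4 = Im (z $ (1,1))"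
  note pq = this
  have T: "T $ 1 $ 1 = 2 * (p1*p4 + q1*q4 + p2*p3 + q2*q3)"
     "T $ 1 $ 2 = 2 * (p1*q4 - q1*p4 - p2*q3 + q2*p3)"
     "T $ 1 $ 3 = 2 * (p1*p3 + q1*q3 - p2*p4 - q2*q4)"
     "T $ 2 $ 1 = 2 * (p1*q4 - q1*p4 + p2*q3 - q2*p3)"
     "T $ 2 $ 2 = 2 * (- p1*p4 - q1*q4 + p2*p3 + q2*q3)"
     "T $ 2 $ 3 = 2 * (p1*q3 - q1*p3 - p2*q4 + q2*p4)"
     "T $ 3 $ 1 = 2 * (p1*p2 + q1*q2 - p3*p4 - q3*q4)"
     "T $ 3 $ 2 = 2 * (p1*q2 - q1*p2 - p3*q4 + q3*p4)"
     "T $ 3 $ 3 = p1^2 + q1^2 - p2^2 - q2^2 - p3^2 - q3^2 + p4^2 + q4^2"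
    unfolding T_def corr_def expect_def
    by (simp_all add: sigma_simps trace_kron sum_two_times_two proj_nth pq[symmetric] algebra_simps power2_eq_square)
  have B: "\<beta> $ 1 = 2 * (p1*p2 + q1*q2 + p3*p4 + q3*q4)"
     "\<beta> $ 2 = 2 * (p1*q2 - q1*p2 + p3*q4 - q3*p4)"
     "\<beta> $ 3 = p1^2 + q1^2 - p2^2 - q2^2 + p3^2 + q3^2 - p4^2 - q4^2"
    unfolding \<beta>_def bloch_def expect_def
    by (simp_all add: sigma_simps trace_kron sum_two_times_two proj_nth mat_def pq[symmetric] algebra_simps power2_eq_square)
  have c: "(cmod (tangle z))\<^sup>2 = 4 * ((p2*p3 - q2*q3 - p1*p4 + q1*q4)^2 + (p2*q3 + q2*p3 - p1*q4 - q1*p4)^2)"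
    by (simp add: cmod_power2 tangle_def pq[symmetric]) (simp add: algebra_simps power2_eq_square)
  have n: "nrm2 z = p1^2 + q1^2 + p2^2 + q2^2 + p3^2 + q3^2 + p4^2 + q4^2"
    by (simp add: nrm2_def sum_two_times_two cmod_power2 pq[symmetric])
  have sym: "T $ 1 $ 1 * T $ 1 $ 1 + T $ 2 $ 1 * T $ 2 $ 1 + T $ 3 $ 1 * T $ 3 $ 1 = (cmod (tangle z))\<^sup>2 + \<beta> $ 1 * \<beta> $ 1"
     "T $ 1 $ 2 * T $ 1 $ 2 + T $ 2 $ 2 * T $ 2 $ 2 + T $ 3 $ 2 * T $ 3 $ 2 = (cmod (tangle z))\<^sup>2 + \<beta> $ 2 * \<beta> $ 2"
     "T $ 1 $ 3 * T $ 1 $ 3 + T $ 2 $ 3 * T $ 2 $ 3 + T $ 3 $ 3 * T $ 3 $ 3 = (cmod (tangle z))\<^sup>2 + \<beta> $ 3 * \<beta> $ 3"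
     "T $ 1 $ 1 * T $ 1 $ 2 + T $ 2 $ 1 * T $ 2 $ 2 + T $ 3 $ 1 * T $ 3 $ 2 = \<beta> $ 1 * \<beta> $ 2"
     "T $ 1 $ 1 * T $ 1 $ 3 + T $ 2 $ 1 * T $ 2 $ 3 + T $ 3 $ 1 * T $ 3 $ 3 = \<beta> $ 1 * \<beta> $ 3"
     "T $ 1 $ 2 * T $ 1 $ 3 + T $ 2 $ 2 * T $ 2 $ 3 + T $ 3 $ 2 * T $ 3 $ 3 = \<beta> $ 2 * \<beta> $ 3"
    unfolding T B c by algebra+
  have "j = 1 \<or> j = 2 \<or> j = 3" "k = 1 \<or> k = 2 \<or> k = 3" using exhaust_3 by auto
  then show "(\<Sum>i\<in>UNIV. T $ i $ j * T $ i $ k) = (if j = k then (cmod (tangle z))\<^sup>2 else 0) + \<beta> $ j * \<beta> $ k"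
    using sym unfolding sum_3 by (elim disjE) (simp_all add: mult.commute)
  show "(nrm2 z)\<^sup>2 = (cmod (tangle z))\<^sup>2 + \<beta> \<bullet> \<beta>"
    unfolding inner_vec_def sum_3 n c B inner_real_def by algebra
qed

lemma pure_corr_norm:
  "(corr (proj z) *v v) \<bullet> (corr (proj z) *v v) = (cmod (tangle z))\<^sup>2 * (v \<bullet> v) + (bloch (proj z) \<bullet> v)\<^sup>2"
proof -
  define T where "T = corr (proj z)"
  define \<beta> where "\<beta> = bloch (proj z)"
  have "(T *v v) \<bullet> (T *v v) = (\<Sum>i\<in>UNIV. \<Sum>j\<in>UNIV. \<Sum>k\<in>UNIV. T $ i $ j * T $ i $ k * (v $ j * v $ k))"
    by (simp add: inner_vec_def matrix_vector_mult_def sum_product mult_ac)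
  also have "\<dots> = (\<Sum>j\<in>UNIV. \<Sum>k\<in>UNIV. (\<Sum>i\<in>UNIV. T $ i $ j * T $ i $ k) * (v $ j * v $ k))"
    unfolding sum_3 by (simp add: algebra_simps)
  also have "\<dots> = (\<Sum>j\<in>UNIV. \<Sum>k\<in>UNIV. ((if j = k then (cmod (tangle z))\<^sup>2 else 0) + \<beta> $ j * \<beta> $ k) * (v $ j * v $ k))"
    unfolding T_def \<beta>_def pure_corr_gram(1) ..
  also have "\<dots> = (cmod (tangle z))\<^sup>2 * (v \<bullet> v) + (\<beta> \<bullet> v)\<^sup>2"
    unfolding sum_3 inner_vec_def by (simp add: algebra_simps power2_eq_square)
  finally show ?thesis by (simp add: T_def \<beta>_def)
qed

section \<open>The CHSH bound\<close>

lemma bessel_two: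
  fixes x e e' :: "'a::real_inner"
  assumes "e \<bullet> e = 1" "e' \<bullet> e' = 1" "e \<bullet> e' = 0"
  shows "(x \<bullet> e)\<^sup>2 + (x \<bullet> e')\<^sup>2 \<le> x \<bullet> x"
    and "(x \<bullet> e)\<^sup>2 + (x \<bullet> e')\<^sup>2 = x \<bullet> x \<Longrightarrow> x = (x \<bullet> e) *\<^sub>R e + (x \<bullet> e') *\<^sub>R e'"
proof -
  define y where "y = x - (x \<bullet> e) *\<^sub>R e - (x \<bullet> e') *\<^sub>R e'"
  have "e' \<bullet> e = 0" "e \<bullet> x = x \<bullet> e" "e' \<bullet> x = x \<bullet> e'"
    using assms by (simp_all add: inner_commute)
  then have yy: "y \<bullet> y = x \<bullet> x - (x \<bullet> e)\<^sup>2 - (x \<bullet> e')\<^sup>2"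
    using assms by (simp add: y_def inner_diff_left inner_diff_right power2_eq_square)
  moreover have "0 \<le> y \<bullet> y" by simp
  ultimately show "(x \<bullet> e)\<^sup>2 + (x \<bullet> e')\<^sup>2 \<le> x \<bullet> x"
    by linarith
  assume "(x \<bullet> e)\<^sup>2 + (x \<bullet> e')\<^sup>2 = x \<bullet> x"
  with yy have "y \<bullet> y = 0" by linarith
  then show "x = (x \<bullet> e) *\<^sub>R e + (x \<bullet> e') *\<^sub>R e'"
    by (simp add: y_def diff_diff_eq)
qed

text \<open>The diagonals of a rhombus are orthogonal, and for unit sides their squared lengths add
  up to four; \<open>k\<close> and \<open>l\<close> are the cosine and sine of half the angle
  between \<open>b\<close> and \<open>b'\<close>.\<close>

lemma sum_diff_orthonormal:
  fixes b b' :: "real^3"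
  assumes "norm b = 1" "norm b' = 1"
  obtains e e' :: "real^3" and k l :: real where "e \<bullet> e = 1" "e' \<bullet> e' = 1" "e \<bullet> e' = 0"
    "k\<^sup>2 + l\<^sup>2 = 1" "b + b' = (2 * k) *\<^sub>R e" "b - b' = (2 * l) *\<^sub>R e'"
proof -
  have bb: "b \<bullet> b = 1" "b' \<bullet> b' = 1" using assms by (auto simp: norm_eq_1)
  define s t where "s = b + b'" "t = b - b'"
  have st: "s \<bullet> t = 0" using bb by (simp add: s_t_def inner_simps inner_commute)
  have sstt: "s \<bullet> s + t \<bullet> t = 4" using bb by (simp add: s_t_def inner_simps inner_commute)
  \<comment> \<open>If \<open>b' = b\<close> or \<open>b' = - b\<close>, one diagonal vanishes and
    has no direction; any unit vector orthogonal to the other one is then taken.\<close>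
  have unit: "\<exists>e. e \<bullet> e = 1 \<and> e \<bullet> y = 0 \<and> x = norm x *\<^sub>R e" if "x \<bullet> y = 0" for x y :: "real^3"
  proof (cases "x = 0")
    case True
    obtain w where w: "w \<noteq> 0" "orthogonal y w"
      using orthogonal_to_vector_exists[of y] by auto
    show ?thesis using True w
      by (intro exI[of _ "(1 / norm w) *\<^sub>R w"])
        (auto simp: orthogonal_def inner_commute dot_square_norm power2_eq_square field_simps)
  next
    case False
    then show ?thesis using that
      by (intro exI[of _ "(1 / norm x) *\<^sub>R x"]) (auto simp: dot_square_norm power2_eq_square field_simps)
  qed
  obtain e where e: "e \<bullet> e = 1" "e \<bullet> t = 0" "s = norm s *\<^sub>R e" using unit[OF st] by blast
  have "t \<bullet> e = 0" using e by (simp add: inner_commute)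
  then obtain e' where e': "e' \<bullet> e' = 1" "e' \<bullet> e = 0" "t = norm t *\<^sub>R e'" using unit by blast
  have "(norm s / 2)\<^sup>2 + (norm t / 2)\<^sup>2 = 1"
    using sstt by (simp add: power_divide power2_norm_eq_inner)
  then show ?thesis
    using e e' by (intro that[of e e' "norm s / 2" "norm t / 2"]) (auto simp: s_t_def inner_commute)
qed

text \<open>With \<open>X\<close> the left-hand side, the squared distances of \<open>T e\<close>
  and \<open>T e'\<close> from their ideal values, plus the squared length \<open>r\<close> of the
  part of \<beta> outside the plane, add up to \<open>2 * (n * K) * (n * K - X)\<close>.
  Nonnegativity gives the bound, and equality makes all three terms vanish.\<close>

lemma pure_chsh_bound:
  fixes z :: qqvec and a a' e e' :: "real^3" and k l C :: real
  defines "T \<equiv> corr (proj z)" and "\<beta> \<equiv> bloch (proj z)" and "n \<equiv> nrm2 z" and "K \<equiv> sqrt (1 + C\<^sup>2)"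
  assumes on: "e \<bullet> e = 1" "e' \<bullet> e' = 1" "e \<bullet> e' = 0" and kl: "k\<^sup>2 + l\<^sup>2 = 1"
    and aa: "a \<bullet> a = 1" "a' \<bullet> a' = 1" and tz: "cmod (tangle z) = C * n"
  shows "k * (a \<bullet> (T *v e)) + l * (a' \<bullet> (T *v e')) \<le> n * K"
    and "k * (a \<bullet> (T *v e)) + l * (a' \<bullet> (T *v e')) = n * K \<Longrightarrow>
      T *v e = (n * K * k) *\<^sub>R a \<and> T *v e' = (n * K * l) *\<^sub>R a' \<and> \<beta> = (\<beta> \<bullet> e) *\<^sub>R e + (\<beta> \<bullet> e') *\<^sub>R e'"
proof -
  define x where "x = T *v e"
  define x' where "x' = T *v e'"
  define X where "X = k * (a \<bullet> x) + l * (a' \<bullet> x')"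
  define g where "g = x - (n * K * k) *\<^sub>R a"
  define g' where "g' = x' - (n * K * l) *\<^sub>R a'"
  define r where "r = \<beta> \<bullet> \<beta> - ((\<beta> \<bullet> e)\<^sup>2 + (\<beta> \<bullet> e')\<^sup>2)"
  have n0: "0 \<le> n" by (simp add: n_def nrm2_def sum_nonneg)
  have K: "K\<^sup>2 = 1 + C\<^sup>2" "0 < K" by (auto simp: K_def add_pos_nonneg)
  have r: "0 \<le> r" using bessel_two(1)[OF on, of \<beta>] by (simp add: r_def)
  \<comment> \<open>Twice the squared tangle plus the in-plane part of \<beta> equals
    \<open>(cmod (tangle z))\<^sup>2 + n\<^sup>2 - r\<close>, and the tangle has modulus
    \<open>C * n\<close>.\<close>
  have xx: "x \<bullet> x + x' \<bullet> x' = (n * K)\<^sup>2 - r"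
  proof -
    have "x \<bullet> x + x' \<bullet> x' = 2 * (cmod (tangle z))\<^sup>2 + ((\<beta> \<bullet> e)\<^sup>2 + (\<beta> \<bullet> e')\<^sup>2)"
      unfolding x_def x'_def T_def \<beta>_def pure_corr_norm on by simp
    also have "\<dots> = 2 * (cmod (tangle z))\<^sup>2 + \<beta> \<bullet> \<beta> - r" by (simp add: r_def)
    also have "\<dots> = (cmod (tangle z))\<^sup>2 + n\<^sup>2 - r"
      using pure_corr_gram(2)[of z] by (simp add: n_def \<beta>_def)
    finally show ?thesis by (simp add: tz power_mult_distrib K algebra_simps)
  qed
  have "g \<bullet> g + g' \<bullet> g' = (x \<bullet> x + x' \<bullet> x') - 2 * (n * K) * X + (n * K)\<^sup>2 * (k\<^sup>2 + l\<^sup>2)"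
    unfolding g_def g'_def X_def using aa
    by (simp add: inner_simps inner_commute algebra_simps power2_eq_square)
  then have main: "g \<bullet> g + g' \<bullet> g' + r = 2 * (n * K) * (n * K - X)"
    unfolding xx kl by (simp add: power2_eq_square algebra_simps)
  have gg: "0 \<le> g \<bullet> g" "0 \<le> g' \<bullet> g'" by auto
  \<comment> \<open>For \<open>n = 0\<close> the factor in front of \<open>n * K - X\<close>
    vanishes and cannot be cancelled, so this case is settled directly.\<close>
  have X0: "X = 0" if "n = 0"
  proof -
    have "x \<bullet> x + x' \<bullet> x' \<le> 0" using xx r that by simp
    then have "x = 0" "x' = 0"
      using inner_ge_zero[of x] inner_ge_zero[of x'] by (auto simp: add_nonneg_eq_0_iff dest: antisym)
    then show ?thesis by (simp add: X_def)
  qed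
  show "k * (a \<bullet> (T *v e)) + l * (a' \<bullet> (T *v e')) \<le> n * K"
  proof (cases "n = 0")
    case True
    then show ?thesis using X0 by (simp add: X_def x_def x'_def)
  next
    case False
    then have nK: "0 < 2 * (n * K)" using n0 K by simp
    have "0 \<le> 2 * (n * K) * (n * K - X)" using main gg r by linarith
    then have "0 \<le> n * K - X" using nK by (simp add: zero_le_mult_iff)
    then show ?thesis by (simp add: X_def x_def x'_def)
  qed
  show "T *v e = (n * K * k) *\<^sub>R a \<and> T *v e' = (n * K * l) *\<^sub>R a' \<and> \<beta> = (\<beta> \<bullet> e) *\<^sub>R e + (\<beta> \<bullet> e') *\<^sub>R e'"
    if "k * (a \<bullet> (T *v e)) + l * (a' \<bullet> (T *v e')) = n * K"
  proof -
    have "X = n * K" using that by (simp add: X_def x_def x'_def)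
    then have "g \<bullet> g + g' \<bullet> g' + r = 0" using main by simp
    then have "g \<bullet> g = 0" "g' \<bullet> g' = 0" "r = 0" using gg r by linarith+
    then have "g = 0" "g' = 0" "r = 0" by auto
    moreover from \<open>r = 0\<close> have "\<beta> = (\<beta> \<bullet> e) *\<^sub>R e + (\<beta> \<bullet> e') *\<^sub>R e'"
      by (intro bessel_two(2)[OF on]) (simp add: r_def)
    ultimately show ?thesis by (simp add: g_def g'_def x_def x'_def)
  qed
qed

lemma expect_mult_adj: "expect (Z ** adj Z) A B = (\<Sum>i\<in>UNIV. expect (proj (column i Z)) A B)"
proof -
  have "(Z ** adj Z) $ p $ q = (\<Sum>i\<in>UNIV. proj (column i Z) $ p $ q)" for p q
    by (simp add: matrix_mult_nth proj_nth column_def)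
  then have "trace (Z ** adj Z ** kron A B) = (\<Sum>p\<in>UNIV. \<Sum>q\<in>UNIV. \<Sum>i\<in>UNIV.
      proj (column i Z) $ p $ q * (A $ fst q $ fst p * B $ snd q $ snd p))"
    by (simp only: trace_kron sum_distrib_right)
  also have "\<dots> = (\<Sum>p\<in>UNIV. \<Sum>i\<in>UNIV. \<Sum>q\<in>UNIV.
      proj (column i Z) $ p $ q * (A $ fst q $ fst p * B $ snd q $ snd p))"
    by (rule sum.cong[OF refl], rule sum.swap)
  also have "\<dots> = (\<Sum>i\<in>UNIV. trace (proj (column i Z) ** kron A B))"
    unfolding trace_kron by (rule sum.swap)
  finally show ?thesis by (simp add: expect_def)
qed

lemma corr_mult_adj: "corr (Z ** adj Z) *v v = (\<Sum>i\<in>UNIV. corr (proj (column i Z)) *v v)"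
proof -
  have "corr (Z ** adj Z) = (\<Sum>i\<in>UNIV. corr (proj (column i Z)))"
    by (simp add: vec_eq_iff corr_def expect_mult_adj)
  then show ?thesis
    by (simp add: vec_eq_iff matrix_vector_mult_def sum_3 sum.distrib sum_distrib_right)
qed

lemma trace_mult_adj: "trace (Z ** adj Z) = complex_of_real (\<Sum>i\<in>UNIV. nrm2 (column i Z))"
proof -
  have "(Z ** adj Z) $ k $ k = (\<Sum>i\<in>UNIV. complex_of_real ((cmod (Z $ k $ i))\<^sup>2))" for k
    by (simp only: matrix_mult_nth adj_nth complex_norm_square)
  then have "trace (Z ** adj Z) = (\<Sum>k\<in>UNIV. \<Sum>i\<in>UNIV. complex_of_real ((cmod (Z $ k $ i))\<^sup>2))"
    by (simp only: trace_def)
  also have "\<dots> = (\<Sum>i\<in>UNIV. \<Sum>k\<in>UNIV. complex_of_real ((cmod (Z $ k $ i))\<^sup>2))"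
    by (rule sum.swap)
  finally show ?thesis by (simp add: nrm2_def column_def)
qed

definition chsh_value :: "qqmat \<Rightarrow> real^3 \<Rightarrow> real^3 \<Rightarrow> real^3 \<Rightarrow> real^3 \<Rightarrow> real" where
  "chsh_value \<rho> a a' b b' = a \<bullet> (corr \<rho> *v (b + b')) + a' \<bullet> (corr \<rho> *v (b - b'))"

lemma chsh_value_bound:
  assumes "density \<rho>" and ab: "norm a = 1" "norm a' = 1" "norm b = 1" "norm b' = 1"
  shows "chsh_value \<rho> a a' b b' \<le> 2 * sqrt (1 + (concurrence \<rho>)\<^sup>2)"
    and "chsh_value \<rho> a a' b b' = 2 * sqrt (1 + (concurrence \<rho>)\<^sup>2) \<Longrightarrow>
       \<exists>v w. norm v = 1 \<and> norm w = 1 \<and> v \<bullet> (corr \<rho> *v w) = 1"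
proof -
  define C where "C = concurrence \<rho>"
  define K where "K = sqrt (1 + C\<^sup>2)"
  obtain Z where \<rho>: "\<rho> = Z ** adj Z"
    and Z: "\<And>i. cmod ((transpose Z ** YY ** Z) $ i $ i) = concurrence \<rho> * Re ((adj Z ** Z) $ i $ i)"
    using wootters_decomposition[OF assms(1)] by blast
  define T where "T = (\<lambda>i. corr (proj (column i Z)))"
  define \<beta> where "\<beta> = (\<lambda>i. bloch (proj (column i Z)))"
  define n where "n = (\<lambda>i. nrm2 (column i Z))"
  have tz: "cmod (tangle (column i Z)) = C * n i" for i
    using Z[of i] unfolding tangle_column nrm2_column by (simp add: C_def n_def)
  have "complex_of_real (\<Sum>i\<in>UNIV. n i) = 1"
    using assms(1) unfolding n_def trace_mult_adj[symmetric] \<rho>[symmetric] by (simp add: density_def)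
  then have sum_n: "(\<Sum>i\<in>UNIV. n i) = 1" using of_real_eq_1_iff by blast
  have n0: "0 \<le> n i" for i by (simp add: n_def nrm2_def sum_nonneg)
  obtain e e' k l where on: "e \<bullet> e = 1" "e' \<bullet> e' = 1" "e \<bullet> e' = 0" and kl: "k\<^sup>2 + l\<^sup>2 = 1"
    and b: "b + b' = (2 * k) *\<^sub>R e" "b - b' = (2 * l) *\<^sub>R e'"
    using sum_diff_orthonormal[OF ab(3,4)] by blast
  have aa: "a \<bullet> a = 1" "a' \<bullet> a' = 1" using ab by (auto simp: norm_eq_1)
  define X where "X = (\<lambda>i. k * (a \<bullet> (T i *v e)) + l * (a' \<bullet> (T i *v e')))"
  have corr: "corr \<rho> *v v = (\<Sum>i\<in>UNIV. T i *v v)" for v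
    unfolding \<rho> T_def by (rule corr_mult_adj)
  have val: "chsh_value \<rho> a a' b b' = 2 * (\<Sum>i\<in>UNIV. X i)"
    unfolding chsh_value_def b matrix_vector_mult_scaleR corr X_def
    by (simp add: inner_sum_right sum.distrib sum_distrib_left mult_ac)
  have Xle: "X i \<le> n i * K" for i
    unfolding X_def T_def n_def K_def
    by (rule pure_chsh_bound(1)[OF on kl aa]) (use tz[of i] in \<open>simp add: n_def\<close>)
  have sum_nK: "(\<Sum>i\<in>UNIV. n i * K) = K" using sum_n by (simp flip: sum_distrib_right)
  have "(\<Sum>i\<in>UNIV. X i) \<le> (\<Sum>i\<in>UNIV. n i * K)" by (rule sum_mono) (rule Xle)
  then show "chsh_value \<rho> a a' b b' \<le> 2 * sqrt (1 + (concurrence \<rho>)\<^sup>2)"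
    unfolding val sum_nK by (simp add: K_def C_def)
  show "\<exists>v w. norm v = 1 \<and> norm w = 1 \<and> v \<bullet> (corr \<rho> *v w) = 1"
    if "chsh_value \<rho> a a' b b' = 2 * sqrt (1 + (concurrence \<rho>)\<^sup>2)"
  proof -
    have "(\<Sum>i\<in>UNIV. n i * K - X i) = 0"
      using that unfolding val sum_subtractf sum_nK by (simp add: K_def C_def)
    then have "\<forall>i\<in>UNIV. n i * K - X i = 0"
      by (subst (asm) sum_nonneg_eq_0_iff) (use Xle in \<open>auto simp del: split_paired_All\<close>)
    then have Xeq: "X i = n i * K" for i
      by (metis UNIV_I eq_iff_diff_eq_0)
    have eqs: "T i *v e = (n i * K * k) *\<^sub>R a \<and> T i *v e' = (n i * K * l) *\<^sub>R a'
        \<and> \<beta> i = (\<beta> i \<bullet> e) *\<^sub>R e + (\<beta> i \<bullet> e') *\<^sub>R e'" for i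
      unfolding T_def n_def K_def \<beta>_def
      by (rule pure_chsh_bound(2)[OF on kl aa])
        (use tz[of i] Xeq[of i] in \<open>simp_all add: n_def X_def T_def K_def\<close>)
    \<comment> \<open>The weights \<open>n i\<close> sum to one, so on the plane each
      \<open>T i\<close> is \<open>n i\<close> times the correlation matrix of \<rho>.\<close>
    have Re: "corr \<rho> *v e = (K * k) *\<^sub>R a" "corr \<rho> *v e' = (K * l) *\<^sub>R a'"
      unfolding corr using eqs sum_n
      by (simp_all add: mult.assoc flip: scaleR_scaleR scaleR_left.sum sum_distrib_right)
    obtain i where i: "n i \<noteq> 0" using sum_n by (metis sum.neutral zero_neq_one)
    \<comment> \<open>The direction is that of \<open>\<beta> i\<close>, which lies in the plane; if
      \<open>\<beta> i = 0\<close>, the Gram identity already gives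
      \<open>(C * n i)\<^sup>2 = (n i)\<^sup>2\<close> and \<open>e\<close> serves.\<close>
    obtain s t where w: "((s *\<^sub>R e + t *\<^sub>R e') :: real^3) \<bullet> (s *\<^sub>R e + t *\<^sub>R e') = 1"
      "(C * n i)\<^sup>2 + (\<beta> i \<bullet> (s *\<^sub>R e + t *\<^sub>R e'))\<^sup>2 = (n i)\<^sup>2"
    proof (cases "\<beta> i = 0")
      case True
      then have "(C * n i)\<^sup>2 = (n i)\<^sup>2"
        using pure_corr_gram(2)[of "column i Z"] tz[of i] by (simp add: \<beta>_def n_def)
      then show ?thesis using that[of 1 0] on True by simp
    next
      case False
      have "(n i)\<^sup>2 = (C * n i)\<^sup>2 + \<beta> i \<bullet> \<beta> i"
        using pure_corr_gram(2)[of "column i Z"] tz[of i] by (simp add: \<beta>_def n_def)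
      moreover have "((\<beta> i \<bullet> e) / norm (\<beta> i)) *\<^sub>R e + ((\<beta> i \<bullet> e') / norm (\<beta> i)) *\<^sub>R e' = (1 / norm (\<beta> i)) *\<^sub>R \<beta> i"
        by (subst (5) conjunct2[OF conjunct2[OF eqs]]) (simp add: scaleR_add_right)
      moreover have "\<beta> i \<bullet> ((1 / norm (\<beta> i)) *\<^sub>R \<beta> i) = norm (\<beta> i)"
        using False by (simp add: dot_square_norm power2_eq_square)
      moreover have "((1 / norm (\<beta> i)) *\<^sub>R \<beta> i) \<bullet> ((1 / norm (\<beta> i)) *\<^sub>R \<beta> i) = 1"
        using False by (simp add: dot_square_norm power2_eq_square)
      ultimately show ?thesis
        using that[of "(\<beta> i \<bullet> e) / norm (\<beta> i)" "(\<beta> i \<bullet> e') / norm (\<beta> i)"]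
        by (simp add: power2_norm_eq_inner)
    qed
    define w where "w = s *\<^sub>R e + t *\<^sub>R e'"
    define v where "v = corr \<rho> *v w"
    \<comment> \<open>One piece of nonzero weight suffices: \<open>T i *v w\<close> has length
      \<open>n i\<close>, so \<open>v\<close> is a unit vector and its product with
      \<open>corr \<rho> *v w\<close>, which is \<open>v\<close> itself, is one.\<close>
    have "T i *v w = n i *\<^sub>R v"
      unfolding w_def v_def matrix_vector_right_distrib matrix_vector_mult_scaleR Re
      using eqs[of i] by (simp add: scaleR_add_right mult_ac)
    moreover have "(T i *v w) \<bullet> (T i *v w) = (n i)\<^sup>2"
      unfolding T_def pure_corr_norm using w tz[of i] by (simp add: w_def \<beta>_def)
    ultimately have "v \<bullet> v = 1" using i by (simp add: power2_eq_square)
    moreover have "w \<bullet> w = 1" using w by (simp add: w_def)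
    ultimately show ?thesis
      by (intro exI[of _ v] exI[of _ w]) (simp add: norm_eq_1 flip: v_def)
  qed
qed

section \<open>Local unitaries and attainment of the maximum\<close>

lemma dot_sigma_nth [simp]:
  "dot_sigma a $ 0 $ 0 = complex_of_real (a $ 3)" "dot_sigma a $ 0 $ 1 = Complex (a $ 1) (- (a $ 2))"
  "dot_sigma a $ 1 $ 0 = Complex (a $ 1) (a $ 2)" "dot_sigma a $ 1 $ 1 = - complex_of_real (a $ 3)"
  by (simp_all add: dot_sigma_def complex_eq_iff)

lemma dot_sigma_square: "dot_sigma a ** dot_sigma a = mat (complex_of_real (a \<bullet> a))"
  by (simp add: vec_eq_iff all_two matrix_mult_nth sum_two mat_def inner_vec_def sum_3 complex_eq_iff)

lemma hermitian_dot_sigma: "hermitian (dot_sigma a)"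
  by (simp add: hermitian_def vec_eq_iff all_two complex_eq_iff)

lemma trace_dot_sigma: "trace (dot_sigma a) = 0"
  by (simp add: trace_def sum_two)

lemma hermitian_traceless_eq_dot_sigma:
  fixes M :: qmat
  assumes "hermitian M" "trace M = 0"
  obtains a where "M = dot_sigma a"
proof -
  have M: "cnj (M $ i $ j) = M $ j $ i" for i j
    using assms(1) by (metis hermitian_def adj_nth)
  have "Im (M $ 0 $ 0) = 0" using M[of 0 0] by (simp add: complex_eq_iff)
  moreover have "M $ 1 $ 1 = - M $ 0 $ 0" using assms(2) by (simp add: trace_def sum_two add_eq_0_iff)
  moreover have "M $ 0 $ 1 = cnj (M $ 1 $ 0)" using M by simp
  ultimately have "M = dot_sigma (vector [Re (M $ 1 $ 0), Im (M $ 1 $ 0), Re (M $ 0 $ 0)])"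
    by (simp add: vec_eq_iff all_two complex_eq_iff)
  then show ?thesis by (rule that)
qed

text \<open>Spin observables are the traceless Hermitian matrices with square one, and conjugation
  preserves all three properties; this avoids writing down the rotation of space induced by
  \<open>U\<close>.\<close>

lemma unitary_conj_dot_sigma:
  assumes "unitary U" "norm a = 1"
  obtains a' where "norm a' = 1" "U ** dot_sigma a ** adj U = dot_sigma a'"
proof -
  define M where "M = U ** dot_sigma a ** adj U"
  have "hermitian M"
    using hermitian_dot_sigma[of a] by (simp add: M_def hermitian_def adj_mult matrix_mul_assoc)
  moreover have "trace M = 0"
  proof -
    have "trace M = trace (adj U ** (U ** dot_sigma a))" unfolding M_def by (rule trace_mul_sym)
    also have "\<dots> = 0" by (simp add: matrix_mul_assoc unitaryD[OF assms(1)] trace_dot_sigma)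
    finally show ?thesis .
  qed
  ultimately obtain a' where a': "M = dot_sigma a'" by (rule hermitian_traceless_eq_dot_sigma)
  have "M ** M = U ** (dot_sigma a ** (adj U ** U) ** dot_sigma a) ** adj U"
    unfolding M_def by (simp only: matrix_mul_assoc)
  also have "\<dots> = mat 1"
    using assms by (simp add: unitaryD dot_sigma_square norm_eq_1)
  finally have "mat (complex_of_real (a' \<bullet> a')) = (mat 1 :: qmat)"
    unfolding a' dot_sigma_square .
  then have "(mat (complex_of_real (a' \<bullet> a')) :: qmat) $ 0 $ 0 = (mat 1 :: qmat) $ 0 $ 0" by simp
  then have "a' \<bullet> a' = 1" by (simp add: mat_def)
  then show ?thesis using a' that unfolding M_def by (simp add: norm_eq_1)
qed

lemma dot_sigma_diagonalisation:
  assumes "norm a = 1"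
  obtains U where "unitary U" "dot_sigma a = U ** pauliZ ** adj U"
proof -
  obtain U \<mu> where U: "unitary U" and a: "dot_sigma a = U ** diagm (\<lambda>i. complex_of_real (\<mu> i)) ** adj U"
    using hermitian_diagonalisation[OF hermitian_dot_sigma] by blast
  define D where "D = diagm (\<lambda>i. complex_of_real (\<mu> i))"
  have D: "D = adj U ** dot_sigma a ** U"
  proof -
    have "adj U ** dot_sigma a ** U = (adj U ** U) ** D ** (adj U ** U)"
      unfolding a D_def by (simp only: matrix_mul_assoc)
    then show ?thesis by (simp add: unitaryD U)
  qed
  have "D ** D = adj U ** (dot_sigma a ** (U ** adj U) ** dot_sigma a) ** U"
    unfolding D by (simp only: matrix_mul_assoc)
  also have "\<dots> = mat 1" using assms by (simp add: unitaryD U dot_sigma_square norm_eq_1)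
  finally have "(D ** D) $ 0 $ 0 = 1" by (simp add: mat_def)
  then have "complex_of_real (\<mu> 0 * \<mu> 0) = 1" by (simp add: D_def)
  then have "\<mu> 0 * \<mu> 0 = 1" using of_real_eq_1_iff by blast
  then have \<mu>0: "\<mu> 0 = 1 \<or> \<mu> 0 = -1" by (simp add: square_eq_1_iff)
  have "trace D = trace (U ** (adj U ** dot_sigma a))"
    unfolding D by (rule trace_mul_sym)
  also have "\<dots> = 0" by (simp add: matrix_mul_assoc unitaryD U trace_dot_sigma)
  finally have "complex_of_real (\<mu> 0 + \<mu> 1) = 0" by (simp add: D_def trace_def sum_two)
  then have \<mu>1: "\<mu> 1 = - \<mu> 0" by (metis add_eq_0_iff of_real_eq_0_iff)
  show ?thesis
  proof (cases "\<mu> 0 = 1")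
    case True
    then have "D = pauliZ" using \<mu>1 by (simp add: D_def vec_eq_iff all_two)
    then show ?thesis using that[OF U] a by (simp add: D_def)
  next
    case False
    \<comment> \<open>Trace zero and square one force the eigenvalues to be 1 and -1; here they come
      in the wrong order, and \<open>pauliX\<close> swaps them.\<close>
    have X: "unitary pauliX" "adj pauliX = pauliX"
      by (simp_all add: unitary_iff vec_eq_iff all_two matrix_mult_nth sum_two mat_def)
    have "D = pauliX ** pauliZ ** pauliX"
      using False \<mu>0 \<mu>1 by (simp add: D_def vec_eq_iff all_two matrix_mult_nth sum_two)
    then have "dot_sigma a = (U ** pauliX) ** pauliZ ** adj (U ** pauliX)"
      unfolding a D_def[symmetric] adj_mult X(2) by (simp only: matrix_mul_assoc)
    then show ?thesis using that[OF unitary_mult[OF U X(1)]] by blast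
  qed
qed

lemma expect_local_unitary:
  assumes "unitary UA" "unitary UB"
  shows "expect (kron UA UB ** \<rho> ** adj (kron UA UB)) (UA ** A ** adj UA) (UB ** B ** adj UB) = expect \<rho> A B"
proof -
  define U where "U = kron UA UB"
  have U: "unitary U" unfolding U_def using assms by (rule unitary_kron)
  have "kron (UA ** A ** adj UA) (UB ** B ** adj UB) = U ** kron A B ** adj U"
    by (simp add: U_def adj_kron kron_mult)
  then have "trace (U ** \<rho> ** adj U ** kron (UA ** A ** adj UA) (UB ** B ** adj UB))
      = trace ((U ** (\<rho> ** (adj U ** U) ** kron A B)) ** adj U)"
    by (simp only: matrix_mul_assoc)
  also have "\<dots> = trace (adj U ** (U ** (\<rho> ** (adj U ** U) ** kron A B)))"
    by (rule trace_mul_sym)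
  also have "\<dots> = trace (\<rho> ** kron A B)"
    by (simp add: matrix_mul_assoc unitaryD[OF U])
  finally show ?thesis by (simp add: expect_def U_def)
qed

lemma chsh_value_eq_expect:
  "chsh_value \<rho> a a' b b' = expect \<rho> (dot_sigma a) (dot_sigma b) + expect \<rho> (dot_sigma a) (dot_sigma b')
     + expect \<rho> (dot_sigma a') (dot_sigma b) - expect \<rho> (dot_sigma a') (dot_sigma b')"
  unfolding chsh_value_def expect_dot_sigma
  by (simp add: matrix_vector_right_distrib matrix_vector_mult_diff_distrib inner_add_right inner_diff_right)

lemma trace_chsh_op:
  "Re (trace (\<rho> ** (kron (dot_sigma a) (dot_sigma b + dot_sigma b') + kron (dot_sigma a') (dot_sigma b - dot_sigma b'))))
     = chsh_value \<rho> a a' b b'"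
proof -
  have "chsh_value \<rho> a a' b b' = expect \<rho> (dot_sigma a) (dot_sigma b + dot_sigma b') + expect \<rho> (dot_sigma a') (dot_sigma b - dot_sigma b')"
    unfolding chsh_value_def expect_dot_sigma[symmetric] dot_sigma_add dot_sigma_diff ..
  then show ?thesis by (simp add: expect_def matrix_add_ldistrib trace_add)
qed

text \<open>The settings range over a product of four spheres, so compactness turns the supremum
  into a maximum. The equality case can thus work with one optimal choice of measurements.\<close>

lemma nonlocality_attained:
  obtains a a' b b' where "norm a = 1" "norm a' = 1" "norm b = 1" "norm b' = 1"
    "nonlocality \<rho> = chsh_value \<rho> a a' b b'"
    "\<And>c c' d d'. norm c = 1 \<Longrightarrow> norm c' = 1 \<Longrightarrow> norm d = 1 \<Longrightarrow> norm d' = 1 \<Longrightarrow>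
       chsh_value \<rho> c c' d d' \<le> nonlocality \<rho>"
proof -
  define P where "P = (sphere 0 1 :: (real^3) set) \<times> (sphere 0 1 :: (real^3) set)
     \<times> (sphere 0 1 :: (real^3) set) \<times> (sphere 0 1 :: (real^3) set)"
  define f where "f = (\<lambda>x. chsh_value \<rho> (fst x) (fst (snd x)) (fst (snd (snd x))) (snd (snd (snd x))))"
  have "compact P" unfolding P_def by (intro compact_Times compact_sphere)
  moreover have "(axis 1 1, axis 1 1, axis 1 1, axis 1 1) \<in> P" by (simp add: P_def)
  then have "P \<noteq> {}" by blast
  moreover have "continuous_on P f"
    unfolding f_def chsh_value_def inner_vec_def matrix_vector_mult_def sum_3
    by (simp add: vector_add_component) (intro continuous_intros)
  ultimately obtain x where x: "x \<in> P" "\<forall>y\<in>P. f y \<le> f x"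
    using continuous_attains_sup by blast
  obtain a a' b b' where abx: "x = (a, a', b, b')" by (metis prod.collapse)
  have ab: "norm a = 1" "norm a' = 1" "norm b = 1" "norm b' = 1"
    using x abx by (auto simp: P_def)
  have max: "chsh_value \<rho> c c' d d' \<le> chsh_value \<rho> a a' b b'"
    if "norm c = 1" "norm c' = 1" "norm d = 1" "norm d' = 1" for c c' d d'
    using x(2)[rule_format, of "(c, c', d, d')"] that abx by (simp add: P_def f_def)
  have "nonlocality \<rho> = chsh_value \<rho> a a' b b'"
    unfolding nonlocality_def
  proof (rule cSup_eq_maximum)
    show "chsh_value \<rho> a a' b b' \<in> (\<lambda>S. Re (trace (\<rho> ** S))) ` chsh_ops"
      unfolding trace_chsh_op[symmetric] chsh_ops_def using ab by blast
    fix y assume "y \<in> (\<lambda>S. Re (trace (\<rho> ** S))) ` chsh_ops"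
    then show "y \<le> chsh_value \<rho> a a' b b'"
      unfolding chsh_ops_def using max by (auto simp: trace_chsh_op)
  qed
  with ab max show ?thesis using that by metis
qed

section \<open>The extremal states\<close>

definition xstate :: "real \<Rightarrow> real \<Rightarrow> complex \<Rightarrow> qqmat" where
  "xstate a d x = (\<chi> i j. if i = (0,0) \<and> j = (0,0) then complex_of_real a
      else if i = (1,1) \<and> j = (1,1) then complex_of_real d
      else if i = (0,0) \<and> j = (1,1) then x
      else if i = (1,1) \<and> j = (0,0) then cnj x else 0)"

lemma mixture_eq_xstate:
  "p *\<^sub>R proj (phi1 \<theta>) + (1 - p) *\<^sub>R proj (phi2 \<theta>) =
     xstate (p * (cos \<theta>)\<^sup>2 + (1 - p) * (sin \<theta>)\<^sup>2) (p * (sin \<theta>)\<^sup>2 + (1 - p) * (cos \<theta>)\<^sup>2) (complex_of_real (sin \<theta> * cos \<theta>))"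
  by (simp add: vec_eq_iff all_two proj_nth phi1_def phi2_def xstate_def complex_eq_iff
      power2_eq_square algebra_simps)

text \<open>The off-diagonal entry fixes \<open>sin (2 * \<theta>) = 2 * x\<close>. With
  \<open>q = cos (2 * \<theta>)\<close> the diagonal entry is
  \<open>(1 + (2 * p - 1) * q) / 2\<close>, and the hypothesis on \<open>x\<^sup>2\<close> says
  precisely that \<open>a\<close> lies in the range of this expression for \<open>p\<close> between
  0 and 1.\<close>

lemma mixture_parameters:
  fixes a x :: real
  assumes "0 \<le> a" "a \<le> 1" "0 \<le> x" "x\<^sup>2 \<le> a * (1 - a)"
  obtains p \<theta> where "0 \<le> p" "p \<le> 1" "0 \<le> \<theta>" "\<theta> < pi" "sin \<theta> * cos \<theta> = x"
    "p * (cos \<theta>)\<^sup>2 + (1 - p) * (sin \<theta>)\<^sup>2 = a"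
proof -
  have quarter: "(2 * a - 1)\<^sup>2 \<le> 1 - (2 * x)\<^sup>2"
    using assms(4) by (simp add: power2_eq_square algebra_simps)
  then have "(2 * x)\<^sup>2 \<le> 1" by (smt (verit) zero_le_power2)
  then have "(2 * x)\<^sup>2 \<le> 1\<^sup>2" by simp
  then have x1: "2 * x \<le> 1" by (rule power2_le_imp_le) simp
  define \<theta> where "\<theta> = arcsin (2 * x) / 2"
  have "0 \<le> arcsin (2 * x)" "arcsin (2 * x) \<le> pi / 2"
    using assms x1 arcsin_le_arcsin[of 0 "2 * x"] arcsin_bounded[of "2 * x"] by auto
  then have \<theta>: "0 \<le> \<theta>" "\<theta> < pi" unfolding \<theta>_def using pi_gt_zero by (simp, linarith)
  have s2: "sin (2 * \<theta>) = 2 * x" using assms x1 by (simp add: \<theta>_def)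
  then have sc: "sin \<theta> * cos \<theta> = x" by (simp add: sin_double)
  define q where "q = cos (2 * \<theta>)"
  have q: "q = sqrt (1 - (2 * x)\<^sup>2)" using assms x1 by (simp add: q_def \<theta>_def cos_arcsin)
  have q0: "0 \<le> q" "q\<^sup>2 = 1 - (2 * x)\<^sup>2"
    using \<open>(2 * x)\<^sup>2 \<le> 1\<close> unfolding q by auto
  have "(2 * a - 1)\<^sup>2 \<le> q\<^sup>2" using quarter q0 by simp
  then have aq: "\<bar>2 * a - 1\<bar> \<le> q" using q0(1) by (metis abs_le_square_iff abs_of_nonneg)
  have csq: "(cos \<theta>)\<^sup>2 = (1 + q) / 2" "(sin \<theta>)\<^sup>2 = (1 - q) / 2"
    by (simp_all add: q_def cos_double_cos sin_squared_eq)
  \<comment> \<open>If \<open>q = 0\<close> the quotient is 0 by convention, and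
    \<open>\<bar>2 * a - 1\<bar> \<le> q\<close> gives \<open>2 * a = 1\<close>, so
    \<open>r * q = 2 * a - 1\<close> still holds.\<close>
  define r where "r = (2 * a - 1) / q"
  have "\<bar>r\<bar> \<le> 1" using aq q0(1) unfolding r_def by (auto simp: divide_le_eq_1)
  then have p: "0 \<le> (1 + r) / 2" "(1 + r) / 2 \<le> 1" by auto
  have "r * q = 2 * a - 1" using aq by (auto simp: r_def)
  then have "(1 + r) / 2 * (cos \<theta>)\<^sup>2 + (1 - (1 + r) / 2) * (sin \<theta>)\<^sup>2 = a"
    unfolding csq by (simp add: field_simps)
  then show ?thesis using that p \<theta> sc by blast
qed

text \<open>A phase on one qubit rotates the coherence between |00> and |11>, so the coherence can
  be made real and nonnegative by a local unitary.\<close>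

lemma xstate_phase:
  assumes "cmod w = 1"
  defines "V \<equiv> kron (diagm (\<lambda>i. if i = 0 then w else 1)) (mat 1)"
  shows "V ** xstate a d x ** adj V = xstate a d (w * x)"
proof -
  have ww: "w * cnj w = 1" using assms(1) by (metis complex_norm_square of_real_1 one_power2)
  have V: "V = diagm (\<lambda>i. if fst i = 0 then w else 1)"
    by (auto simp: V_def vec_eq_iff kron_nth mat_def)
  show ?thesis
    unfolding V adj_diagm by (simp add: vec_eq_iff all_two xstate_def mult.commute ww)
qed

text \<open>Local rotations turn both spin directions into \<open>pauliZ\<close>. Perfect
  correlation then empties |01> and |10>, positivity clears their rows and columns, and
  Cauchy-Schwarz bounds the remaining coherence as \<open>mixture_parameters\<close>
  requires.\<close>

lemma perfectly_correlated_in_Qset: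
  assumes "density \<rho>" "norm v = 1" "norm w = 1" "v \<bullet> (corr \<rho> *v w) = 1"
  shows "\<rho> \<in> Qset"
proof -
  obtain UA where UA: "unitary UA" "dot_sigma v = UA ** pauliZ ** adj UA"
    using dot_sigma_diagonalisation[OF assms(2)] by blast
  obtain UB where UB: "unitary UB" "dot_sigma w = UB ** pauliZ ** adj UB"
    using dot_sigma_diagonalisation[OF assms(3)] by blast
  define U where "U = kron UA UB"
  have U: "unitary U" unfolding U_def using UA UB by (simp add: unitary_kron)
  define P where "P = msqrt \<rho>"
  have P: "psd P" "P ** P = \<rho>" unfolding P_def using assms(1) by (auto intro: psd_msqrt simp: density_def)
  then have adjP: "adj P = P" by (simp add: psd_def hermitian_def)
  \<comment> \<open>Positivity is used through a factor: a vanishing diagonal entry of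
    \<open>B ** adj B\<close> forces a vanishing row of \<open>B\<close>.\<close>
  define B where "B = adj U ** P"
  define \<rho>' where "\<rho>' = B ** adj B"
  have \<rho>': "\<rho>' = adj U ** \<rho> ** U"
    unfolding \<rho>'_def B_def adj_mult adj_adj adjP P(2)[symmetric] by (simp only: matrix_mul_assoc)
  have "U ** \<rho>' ** adj U = (U ** adj U) ** \<rho> ** (U ** adj U)"
    unfolding \<rho>' by (simp only: matrix_mul_assoc)
  then have \<rho>: "\<rho> = U ** \<rho>' ** adj U" by (simp add: unitaryD U)
  have "expect \<rho>' pauliZ pauliZ = expect \<rho> (dot_sigma v) (dot_sigma w)"
    unfolding UA(2) UB(2) using expect_local_unitary[OF UA(1) UB(1), of \<rho>' pauliZ pauliZ] \<rho>
    by (simp add: U_def)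
  then have "expect \<rho>' pauliZ pauliZ = 1" using assms(4) by (simp add: expect_dot_sigma)
  then have zz: "Re (\<rho>' $ (0,0) $ (0,0)) - Re (\<rho>' $ (0,1) $ (0,1)) - Re (\<rho>' $ (1,0) $ (1,0)) + Re (\<rho>' $ (1,1) $ (1,1)) = 1"
    by (simp add: expect_def trace_kron sum_two_times_two)
  have "trace \<rho>' = trace (U ** (adj U ** \<rho>))" unfolding \<rho>' by (rule trace_mul_sym)
  also have "\<dots> = 1" using assms(1) by (simp add: matrix_mul_assoc unitaryD U density_def)
  finally have tr: "Re (\<rho>' $ (0,0) $ (0,0)) + Re (\<rho>' $ (0,1) $ (0,1)) + Re (\<rho>' $ (1,0) $ (1,0)) + Re (\<rho>' $ (1,1) $ (1,1)) = 1"
    by (simp add: trace_def sum_two_times_two complex_eq_iff)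
  have diag: "\<rho>' $ k $ k = complex_of_real (\<Sum>j\<in>UNIV. (cmod (B $ k $ j))\<^sup>2)" for k
    unfolding of_real_sum complex_norm_square by (simp add: \<rho>'_def matrix_mult_nth)
  have diag0: "0 \<le> Re (\<rho>' $ k $ k)" for k
    unfolding diag by (simp add: sum_nonneg)
  \<comment> \<open>The difference of \<open>tr\<close> and \<open>zz\<close> is twice the sum of
    these two nonnegative entries.\<close>
  have z: "Re (\<rho>' $ (0,1) $ (0,1)) = 0" "Re (\<rho>' $ (1,0) $ (1,0)) = 0"
    using zz tr diag0[of "(0,1)"] diag0[of "(1,0)"] by linarith+
  have row0: "B $ k $ j = 0" if "Re (\<rho>' $ k $ k) = 0" for k j
    using that unfolding diag by (simp add: sum_nonneg_eq_0_iff del: split_paired_All)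
  have B0: "B $ (0,1) $ j = 0" "B $ (1,0) $ j = 0" for j
    using row0 z by auto
  define a where "a = Re (\<rho>' $ (0,0) $ (0,0))"
  define d where "d = Re (\<rho>' $ (1,1) $ (1,1))"
  define x where "x = \<rho>' $ (0,0) $ (1,1)"
  have ad: "0 \<le> a" "0 \<le> d" "a + d = 1"
    using diag0 tr z by (auto simp: a_def d_def)
  have x2: "(cmod x)\<^sup>2 \<le> a * d"
  proof -
    have "cmod x \<le> (\<Sum>j\<in>UNIV. cmod (B $ (0,0) $ j) * cmod (B $ (1,1) $ j))"
      unfolding x_def \<rho>'_def matrix_mult_nth
      by (rule order.trans[OF norm_sum]) (simp add: norm_mult)
    then have "(cmod x)\<^sup>2 \<le> (\<Sum>j\<in>UNIV. cmod (B $ (0,0) $ j) * cmod (B $ (1,1) $ j))\<^sup>2"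
      by (rule power_mono) simp
    also have "\<dots> \<le> (\<Sum>j\<in>UNIV. (cmod (B $ (0,0) $ j))\<^sup>2) * (\<Sum>j\<in>UNIV. (cmod (B $ (1,1) $ j))\<^sup>2)"
      by (rule Cauchy_Schwarz_ineq_sum)
    also have "\<dots> = a * d" unfolding a_def d_def diag by simp
    finally show ?thesis .
  qed
  have herm: "\<rho>' $ i $ j = cnj (\<rho>' $ j $ i)" for i j
    by (simp add: \<rho>'_def matrix_mult_nth mult.commute)
  have \<rho>'x: "\<rho>' = xstate a d x"
  proof -
    have "\<rho>' $ (0,1) $ j = 0" "\<rho>' $ (1,0) $ j = 0" for j
      by (simp_all add: \<rho>'_def matrix_mult_nth B0)
    then have r0: "\<rho>' $ (0,1) $ j = 0" "\<rho>' $ (1,0) $ j = 0" "\<rho>' $ j $ (0,1) = 0" "\<rho>' $ j $ (1,0) = 0" for j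
      using herm[of j] by auto
    have "\<rho>' $ (0,0) $ (0,0) = complex_of_real a" "\<rho>' $ (1,1) $ (1,1) = complex_of_real d"
      unfolding a_def d_def diag by simp_all
    then show ?thesis
      using r0 herm[of "(1,1)" "(0,0)"]
      by (simp add: vec_eq_iff all_two xstate_def x_def)
  qed
  define ph where "ph = (if x = 0 then 1 else x / complex_of_real (cmod x))"
  have ph: "cmod ph = 1" "x = ph * complex_of_real (cmod x)"
    by (auto simp: ph_def norm_divide)
  define V where "V = diagm (\<lambda>i::2. if i = 0 then ph else 1)"
  have V: "unitary V" unfolding V_def by (rule unitary_diagm) (simp add: ph)
  obtain p \<theta> where p: "0 \<le> p" "p \<le> 1" "0 \<le> \<theta>" "\<theta> < pi" "sin \<theta> * cos \<theta> = cmod x"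
    "p * (cos \<theta>)\<^sup>2 + (1 - p) * (sin \<theta>)\<^sup>2 = a"
    using mixture_parameters[of a "cmod x"] ad x2 by (metis add_diff_cancel_left' le_add_same_cancel1 norm_ge_zero)
  have "p * (sin \<theta>)\<^sup>2 + (1 - p) * (cos \<theta>)\<^sup>2 = 1 - (p * (cos \<theta>)\<^sup>2 + (1 - p) * (sin \<theta>)\<^sup>2)"
    by (simp add: sin_squared_eq algebra_simps)
  then have mix: "p *\<^sub>R proj (phi1 \<theta>) + (1 - p) *\<^sub>R proj (phi2 \<theta>) = xstate a d (complex_of_real (cmod x))"
    unfolding mixture_eq_xstate p(5,6) using ad by (metis add_diff_cancel_left')
  define M where "M = kron V (mat 1)"
  have "M ** xstate a d (complex_of_real (cmod x)) ** adj M = \<rho>'"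
    unfolding \<rho>'x M_def V_def xstate_phase[OF ph(1)] using ph(2) by simp
  then have "\<rho> = U ** (M ** (p *\<^sub>R proj (phi1 \<theta>) + (1 - p) *\<^sub>R proj (phi2 \<theta>)) ** adj M) ** adj U"
    unfolding mix using \<rho> by simp
  also have "\<dots> = (U ** M) ** (p *\<^sub>R proj (phi1 \<theta>) + (1 - p) *\<^sub>R proj (phi2 \<theta>)) ** adj (U ** M)"
    unfolding adj_mult by (simp only: matrix_mul_assoc)
  also have "U ** M = kron (UA ** V) UB"
    unfolding U_def M_def kron_mult by simp
  finally show ?thesis
    unfolding Qset_def using unitary_mult[OF UA(1) V] UB(1) p by blast
qed

text \<open>An antisymmetric form in dimension two is multiplied by the determinant under
  congruence. As the determinant of a unitary is a phase, local unitaries leave the concurrence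
  unchanged.\<close>

lemma transpose_pauliY_conj: "transpose U ** pauliY ** U = diagm (\<lambda>_. U $ 0 $ 0 * U $ 1 $ 1 - U $ 0 $ 1 * U $ 1 $ 0) ** pauliY"
  by (simp add: vec_eq_iff all_two matrix_mult3_nth sum_two transpose_def algebra_simps)

text \<open>By the previous identity the determinant times \<open>pauliY\<close> is a product of
  unitaries.\<close>

lemma cmod_det_unitary2:
  assumes "unitary (U :: qmat)"
  shows "cmod (U $ 0 $ 0 * U $ 1 $ 1 - U $ 0 $ 1 * U $ 1 $ 0) = 1"
proof -
  define \<delta> where "\<delta> = U $ 0 $ 0 * U $ 1 $ 1 - U $ 0 $ 1 * U $ 1 $ 0"
  have "unitary (transpose U)"
    using assms unfolding unitary_iff transpose_eq_conjm_adj adj_conjm adj_adj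
    by (metis assms conjm_mat conjm_mult unitaryD(2))
  moreover have "unitary pauliY"
    by (simp add: unitary_iff vec_eq_iff all_two matrix_mult_nth sum_two mat_def)
  ultimately have "unitary (diagm (\<lambda>_. \<delta>) ** pauliY)"
    unfolding \<delta>_def transpose_pauliY_conj[symmetric] by (intro unitary_mult assms)
  then have "(adj (diagm (\<lambda>_. \<delta>) ** pauliY) ** (diagm (\<lambda>_. \<delta>) ** pauliY)) $ 0 $ 0 = 1"
    unfolding unitary_iff by (simp add: mat_def)
  then have "cnj \<delta> * \<delta> = 1"
    by (simp add: matrix_mult_nth[of "adj _"] sum_two mult_ac)
  then have "(cmod \<delta>)\<^sup>2 = 1"
    by (metis complex_norm_square mult.commute of_real_eq_1_iff)
  then have "cmod \<delta> = 1"
    by (metis norm_ge_zero one_power2 power2_eq_iff_nonneg zero_le_one)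
  then show ?thesis by (simp add: \<delta>_def)
qed

text \<open>An explicit factor of the state already diagonalises the symmetric form, with moduli
  \<open>2 * g * c\<^sup>2\<close>, \<open>2 * g * s\<^sup>2\<close> and zeros; the gap is the
  difference of the first two.\<close>

lemma concurrence_local_xstate:
  assumes "unitary UA" "unitary UB" "0 \<le> a" "0 \<le> d" "x\<^sup>2 \<le> a * d"
  shows "concurrence (kron UA UB ** xstate a d (complex_of_real x) ** adj (kron UA UB)) = 2 * \<bar>x\<bar>"
proof -
  define g where "g = sqrt (a * d)"
  have g0: "0 \<le> g" using assms by (simp add: g_def)
  have "\<bar>x\<bar> \<le> g" using assms(5) unfolding g_def by (simp add: real_le_rsqrt)
  then have "\<exists>\<eta>. g * cos (2 * \<eta>) = x"
  proof (cases "g = 0")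
    case False
    with \<open>\<bar>x\<bar> \<le> g\<close> g0 have "- 1 \<le> x / g" "x / g \<le> 1" by (auto simp: field_simps)
    then have "cos (2 * (arccos (x / g) / 2)) = x / g" by simp
    then show ?thesis using False by (metis nonzero_mult_div_cancel_left times_divide_eq_right)
  qed auto
  then obtain \<eta> where \<eta>: "g * cos (2 * \<eta>) = x" by blast
  define s c where "s = sin \<eta>" "c = cos \<eta>"
  have sc: "c\<^sup>2 + s\<^sup>2 = 1" "g * (c\<^sup>2 - s\<^sup>2) = x"
    using \<eta> by (simp_all add: s_c_def cos_double)
  \<comment> \<open>The columns are the vectors \<open>sqrt a\<close> |00> plus or minus
    \<open>sqrt d\<close> |11>, weighted by the cosine and sine of \<eta>, so the coherence is
    \<open>g * cos (2 * \<eta>) = x\<close>. The factor \<open>\<i>\<close> gives both tangles the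
    same sign.\<close>
  define W0 :: qqmat where "W0 = (\<chi> i j.
      if i = (0,0) \<and> j = (0,0) then complex_of_real (sqrt a * c)
      else if i = (0,0) \<and> j = (1,1) then \<i> * complex_of_real (sqrt a * s)
      else if i = (1,1) \<and> j = (0,0) then complex_of_real (sqrt d * c)
      else if i = (1,1) \<and> j = (1,1) then - \<i> * complex_of_real (sqrt d * s) else 0)"
  have sq: "sqrt a * sqrt a = a" "sqrt d * sqrt d = d" "sqrt a * sqrt d = g" "sqrt d * sqrt a = g"
    using assms by (simp_all add: g_def real_sqrt_mult)
  have W0: "W0 ** adj W0 = xstate a d (complex_of_real x)"
  proof -
    have "sqrt a * c * (sqrt a * c) + sqrt a * s * (sqrt a * s) = a"
      using sc sq by algebra
    moreover have "sqrt d * c * (sqrt d * c) + sqrt d * s * (sqrt d * s) = d"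
      using sc sq by algebra
    moreover have "sqrt a * c * (sqrt d * c) - sqrt a * s * (sqrt d * s) = x"
      "sqrt d * c * (sqrt a * c) - sqrt d * s * (sqrt a * s) = x"
      unfolding sc(2)[symmetric] sq(3)[symmetric] by algebra+
    ultimately show ?thesis
      by (simp add: vec_eq_iff all_two matrix_mult_nth sum_two_times_two W0_def xstate_def complex_eq_iff)
  qed
  define \<mu>0 where "\<mu>0 = (\<lambda>i :: 2 \<times> 2. if i = (0,0) then - 2 * g * c\<^sup>2 else if i = (1,1) then - 2 * g * s\<^sup>2 else 0)"
  have YW0: "transpose W0 ** YY ** W0 = diagm (\<lambda>i. complex_of_real (\<mu>0 i))"
  proof -
    have "sqrt a * c * (sqrt d * c) + sqrt d * c * (sqrt a * c) = 2 * g * c\<^sup>2"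
      "sqrt a * s * (sqrt d * s) + sqrt d * s * (sqrt a * s) = 2 * g * s\<^sup>2"
      unfolding sq(3)[symmetric] by algebra+
    then show ?thesis
      by (simp add: vec_eq_iff all_two matrix_mult3_nth sum_two_times_two kron_nth W0_def transpose_def \<mu>0_def complex_eq_iff)
  qed
  define \<delta> where "\<delta> = (\<lambda>U :: qmat. U $ 0 $ 0 * U $ 1 $ 1 - U $ 0 $ 1 * U $ 1 $ 0)"
  have \<delta>: "cmod (\<delta> UA) = 1" "cmod (\<delta> UB) = 1"
    unfolding \<delta>_def using assms cmod_det_unitary2 by auto
  define U where "U = kron UA UB"
  define W where "W = U ** W0"
  have "transpose U ** YY ** U = kron (transpose UA ** pauliY ** UA) (transpose UB ** pauliY ** UB)"
    by (simp add: U_def transpose_kron kron_mult)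
  also have "\<dots> = diagm (\<lambda>_. \<delta> UA * \<delta> UB) ** YY"
    unfolding transpose_pauliY_conj by (simp add: \<delta>_def vec_eq_iff kron_nth)
  finally have UYU: "transpose U ** YY ** U = diagm (\<lambda>_. \<delta> UA * \<delta> UB) ** YY" .
  have "transpose W ** YY ** W = transpose W0 ** (transpose U ** YY ** U) ** W0"
    unfolding W_def matrix_transpose_mul by (simp only: matrix_mul_assoc)
  also have "\<dots> = diagm (\<lambda>_. \<delta> UA * \<delta> UB) ** (transpose W0 ** YY ** W0)"
    unfolding UYU by (simp add: vec_eq_iff matrix_mult3_nth sum_distrib_left mult_ac)
  also have "\<dots> = diagm (\<lambda>i. \<delta> UA * \<delta> UB * complex_of_real (\<mu>0 i))"
    unfolding YW0 diagm_mult_diagm ..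
  finally have YW: "transpose W ** YY ** W = diagm (\<lambda>i. \<delta> UA * \<delta> UB * complex_of_real (\<mu>0 i))" .
  have "U ** xstate a d (complex_of_real x) ** adj U = W ** adj W"
    unfolding W0[symmetric] W_def adj_mult by (simp only: matrix_mul_assoc)
  then have "concurrence (U ** xstate a d (complex_of_real x) ** adj U) = max 0 (gap (\<lambda>i. cmod (\<delta> UA * \<delta> UB * complex_of_real (\<mu>0 i))))"
    using YW by (rule concurrence_eq_gap)
  also have "(\<lambda>i. cmod (\<delta> UA * \<delta> UB * complex_of_real (\<mu>0 i))) = (\<lambda>i. \<bar>\<mu>0 i\<bar>)"
    by (simp add: norm_mult \<delta>)
  also have "gap (\<lambda>i. \<bar>\<mu>0 i\<bar>) = 2 * \<bar>x\<bar>"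
  proof -
    have "range (\<lambda>i. \<bar>\<mu>0 i\<bar>) = {2 * g * c\<^sup>2, 0, 2 * g * s\<^sup>2}"
      unfolding UNIV_two_times_two using g0 by (auto simp: \<mu>0_def abs_mult)
    then have "Max (range (\<lambda>i. \<bar>\<mu>0 i\<bar>)) = max (2 * g * c\<^sup>2) (2 * g * s\<^sup>2)"
      using g0 by (simp add: max_def)
    moreover have "(\<Sum>i\<in>UNIV. \<bar>\<mu>0 i\<bar>) = 2 * g * c\<^sup>2 + 2 * g * s\<^sup>2"
      unfolding sum_two_times_two using g0 by (simp add: \<mu>0_def abs_mult)
    moreover have "2 * g * c\<^sup>2 - 2 * g * s\<^sup>2 = 2 * x" using sc by algebra
    ultimately show ?thesis unfolding gap_def by (simp add: max_def)
  qed
  finally show ?thesis by (simp add: U_def)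
qed

lemma Qset_attains_bound:
  assumes "\<rho> \<in> Qset"
  obtains a a' b b' where "norm a = 1" "norm a' = 1" "norm b = 1" "norm b' = 1"
    "chsh_value \<rho> a a' b b' = 2 * sqrt (1 + (concurrence \<rho>)\<^sup>2)"
proof -
  obtain UA UB p \<theta> where U: "unitary UA" "unitary UB" and p: "0 \<le> p" "p \<le> 1"
    and \<rho>: "\<rho> = kron UA UB ** (p *\<^sub>R proj (phi1 \<theta>) + (1 - p) *\<^sub>R proj (phi2 \<theta>)) ** adj (kron UA UB)"
    using assms unfolding Qset_def by blast
  define \<alpha> where "\<alpha> = p * (cos \<theta>)\<^sup>2 + (1 - p) * (sin \<theta>)\<^sup>2"
  define d where "d = p * (sin \<theta>)\<^sup>2 + (1 - p) * (cos \<theta>)\<^sup>2"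
  define x where "x = sin \<theta> * cos \<theta>"
  define \<rho>0 where "\<rho>0 = xstate \<alpha> d (complex_of_real x)"
  have \<rho>0: "\<rho> = kron UA UB ** \<rho>0 ** adj (kron UA UB)"
    unfolding \<rho> mixture_eq_xstate \<rho>0_def \<alpha>_def d_def x_def ..
  have "0 \<le> \<alpha>" "0 \<le> d" using p by (auto simp: \<alpha>_def d_def)
  moreover have "\<alpha> + d = 1" by (simp add: \<alpha>_def d_def sin_squared_eq algebra_simps)
  ultimately have ad: "0 \<le> \<alpha>" "0 \<le> d" "\<alpha> + d = 1" by auto
  have "\<alpha> * d - x\<^sup>2 = p * (1 - p) * ((cos \<theta>)\<^sup>2 - (sin \<theta>)\<^sup>2)\<^sup>2"
    unfolding \<alpha>_def d_def x_def by algebra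
  moreover have "0 \<le> p * (1 - p) * ((cos \<theta>)\<^sup>2 - (sin \<theta>)\<^sup>2)\<^sup>2" using p by simp
  ultimately have "x\<^sup>2 \<le> \<alpha> * d" by linarith
  then have C: "concurrence \<rho> = 2 * \<bar>x\<bar>"
    unfolding \<rho>0 \<rho>0_def using U ad by (intro concurrence_local_xstate) auto
  define K where "K = sqrt (1 + (2 * x)\<^sup>2)"
  have K: "0 < K" "K\<^sup>2 = 1 + (2 * x)\<^sup>2" by (simp_all add: K_def add_pos_nonneg)
  \<comment> \<open>Obtained by solving the equality condition of \<open>pure_chsh_bound\<close> for
    the correlations 1 along the third axis and \<open>2 * x\<close> along the first: half of
    \<open>b + b'\<close> and half of \<open>b - b'\<close> have coefficients \<open>1 / K\<close>
    and \<open>2 * x / K\<close>.\<close>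
  define b b' :: "real^3" where "b = vector [2 * x / K, 0, 1 / K]" "b' = vector [- (2 * x / K), 0, 1 / K]"
  have "2 * x / K * (2 * x / K) + 1 / K * (1 / K) = (1 + (2 * x)\<^sup>2) / K\<^sup>2"
    by (simp add: power2_eq_square add_divide_distrib)
  also have "\<dots> = 1" unfolding K(2)[symmetric] using K(1) by simp
  finally have nb: "norm b = 1" "norm b' = 1"
    by (simp_all add: norm_eq_1 b_b'_def inner_vec_def sum_3)
  have na: "norm (axis 3 1 :: real^3) = 1" "norm (axis 1 1 :: real^3) = 1" by simp_all
  have val: "chsh_value \<rho>0 (axis 3 1) (axis 1 1) b b' = 2 * K"
  proof -
    have T: "corr \<rho>0 $ 3 $ 1 = 0" "corr \<rho>0 $ 3 $ 3 = 1" "corr \<rho>0 $ 1 $ 1 = 2 * x" "corr \<rho>0 $ 1 $ 3 = 0"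
      using ad by (simp_all add: corr_def expect_def sigma_simps trace_kron sum_two_times_two \<rho>0_def xstate_def)
    have "chsh_value \<rho>0 (axis 3 1) (axis 1 1) b b' = 2 * (1 + (2 * x)\<^sup>2) / K"
      unfolding chsh_value_def
      by (simp add: inner_axis' matrix_vector_mult_def sum_3 T b_b'_def power2_eq_square add_divide_distrib)
    also have "\<dots> = 2 * K" unfolding K(2)[symmetric] using K(1) by (simp add: power2_eq_square)
    finally show ?thesis .
  qed
  \<comment> \<open>The four observables are rotated together with the state, which leaves the CHSH
    value unchanged.\<close>
  obtain a1 where a1: "norm a1 = 1" "UA ** dot_sigma (axis 3 1) ** adj UA = dot_sigma a1"
    using unitary_conj_dot_sigma[OF U(1) na(1)] by blast
  obtain a2 where a2: "norm a2 = 1" "UA ** dot_sigma (axis 1 1) ** adj UA = dot_sigma a2"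
    using unitary_conj_dot_sigma[OF U(1) na(2)] by blast
  obtain b1 where b1: "norm b1 = 1" "UB ** dot_sigma b ** adj UB = dot_sigma b1"
    using unitary_conj_dot_sigma[OF U(2) nb(1)] by blast
  obtain b2 where b2: "norm b2 = 1" "UB ** dot_sigma b' ** adj UB = dot_sigma b2"
    using unitary_conj_dot_sigma[OF U(2) nb(2)] by blast
  have "chsh_value \<rho> a1 a2 b1 b2 = chsh_value \<rho>0 (axis 3 1) (axis 1 1) b b'"
    unfolding chsh_value_eq_expect a1(2)[symmetric] a2(2)[symmetric] b1(2)[symmetric] b2(2)[symmetric]
      \<rho>0 expect_local_unitary[OF U] ..
  then have "chsh_value \<rho> a1 a2 b1 b2 = 2 * sqrt (1 + (concurrence \<rho>)\<^sup>2)"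
    unfolding val C K_def by simp
  then show ?thesis using a1 a2 b1 b2 that by blast
qed

theorem theorem3:
  fixes \<rho> :: qqmat
  assumes "density \<rho>"
  shows "nonlocality \<rho> \<le> 2 * sqrt (1 + (concurrence \<rho>)\<^sup>2)
       \<and> (nonlocality \<rho> = 2 * sqrt (1 + (concurrence \<rho>)\<^sup>2) \<longleftrightarrow> \<rho> \<in> Qset)"
proof -
  obtain a a' b b' where ab: "norm a = 1" "norm a' = 1" "norm b = 1" "norm b' = 1"
    and N: "nonlocality \<rho> = chsh_value \<rho> a a' b b'"
    and max: "\<And>c c' d d'. norm c = 1 \<Longrightarrow> norm c' = 1 \<Longrightarrow> norm d = 1 \<Longrightarrow> norm d' = 1 \<Longrightarrow>
       chsh_value \<rho> c c' d d' \<le> nonlocality \<rho>"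
    using nonlocality_attained by metis
  have le: "nonlocality \<rho> \<le> 2 * sqrt (1 + (concurrence \<rho>)\<^sup>2)"
    unfolding N by (rule chsh_value_bound(1)[OF assms ab])
  have "\<rho> \<in> Qset" if "nonlocality \<rho> = 2 * sqrt (1 + (concurrence \<rho>)\<^sup>2)"
    using chsh_value_bound(2)[OF assms ab] that N perfectly_correlated_in_Qset[OF assms] by metis
  moreover have "2 * sqrt (1 + (concurrence \<rho>)\<^sup>2) \<le> nonlocality \<rho>" if "\<rho> \<in> Qset"
    using Qset_attains_bound[OF that] max by metis
  ultimately show ?thesis using le by (meson order.antisym)
qed

end
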